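(* Let $n$ be a positive integer and let $$E:=u_t-u_{txx}+\frac{(n+1)(n+2)}{2}u^nu_x-\frac{n(n-1)}{2}u^{n-2}u_x^3-2n u^{n-1}u_xu_{xx}-u^n u_{xxx}.$$ The equation $E=0$ admits only two conserved currents with zeroth order characteristic, namely those with characteristics $Q_1=1$ and $Q_2=u$. That is, a smooth function $Q=Q(t,x,u)$ is a zeroth order characteristic of a conservation law of $E=0$ if and only if $Q=c_1+c_2u$ for some constants $c_1,c_2\in\mathbb{R}$.
   Context: Here $u=u(t,x)$ is a real function of two real variables. For $n=1$ the term with coefficient $n(n-1)/2$ is absent. A conserved current of an equation $E=0$ is a pair $(C^0,C^1)$ of smooth functions of $t,x,u$ and finitely many derivatives of $u$ whose divergence $\partial_tC^0+\partial_xC^1$ (total derivatives) vanishes on the solutions of the equation. A characteristic of order $m$ of a conservation law of $E=0$ is a function $Q$ of $t,x,u$ and derivatives of $u$ up to order $m$ such that $\partial_tC^0+\partial_xC^1=QE$ holds identically (for arbitrary smooth $u$) for some such pair $(C^0,C^1)$. A zeroth order characteristic is thus a function $Q=Q(t,x,u)$. *)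

theory Defs
  imports "HOL-Analysis.Analysis"
begin

text \<open>
  Coordinates on the infinite jet space of one real function \<open>u\<close> of two real variables:
  \<open>Uvar i j\<close> stands for the derivative of \<open>u\<close> taken \<open>i\<close> times in \<open>t\<close> and \<open>j\<close> times in \<open>x\<close>.
\<close>

datatype jvar = Tvar | Xvar | Uvar nat nat

type_synonym jet = "jvar \<Rightarrow> real"

definition jvars_upto :: "nat \<Rightarrow> jvar set" where
  "jvars_upto m = {Tvar, Xvar} \<union> {Uvar i j | i j. i + j \<le> m}"

definition depends_only_on :: "(jet \<Rightarrow> real) \<Rightarrow> jvar set \<Rightarrow> bool" where
  "depends_only_on F S \<longleftrightarrow> (\<forall>p q. (\<forall>v\<in>S. p v = q v) \<longrightarrow> F p = F q)"

definition jpartial :: "jvar \<Rightarrow> (jet \<Rightarrow> real) \<Rightarrow> jet \<Rightarrow> real" where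
  "jpartial v F p = deriv (\<lambda>s. F (p(v := s))) (p v)"

text \<open>
  Smoothness: all iterated partial derivatives exist and are continuous.  Continuity refers to
  the product topology on \<open>jvar \<Rightarrow> real\<close>; for a function of finitely many coordinates
  it is ordinary continuity in those coordinates.
\<close>

coinductive jsmooth :: "(jet \<Rightarrow> real) \<Rightarrow> bool" where
  "\<lbrakk> continuous_on UNIV F;
     \<And>v p. (\<lambda>s. F (p(v := s))) differentiable (at (p v));
     \<And>v. jsmooth (jpartial v F) \<rbrakk> \<Longrightarrow> jsmooth F"

definition differential_function_of_order :: "nat \<Rightarrow> (jet \<Rightarrow> real) \<Rightarrow> bool" where
  "differential_function_of_order m F \<longleftrightarrow> depends_only_on F (jvars_upto m) \<and> jsmooth F"

definition differential_function :: "(jet \<Rightarrow> real) \<Rightarrow> bool" where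
  "differential_function F \<longleftrightarrow> (\<exists>m. differential_function_of_order m F)"

text \<open>
  Total derivatives.  A differential function has only finitely many non-zero partial
  derivatives, so for those the sums below are over finite sets.
\<close>

definition total_t :: "(jet \<Rightarrow> real) \<Rightarrow> jet \<Rightarrow> real" where
  "total_t F p = jpartial Tvar F p +
     (\<Sum>(i, j) \<in> {(i, j). jpartial (Uvar i j) F p \<noteq> 0}.
        p (Uvar (Suc i) j) * jpartial (Uvar i j) F p)"

definition total_x :: "(jet \<Rightarrow> real) \<Rightarrow> jet \<Rightarrow> real" where
  "total_x F p = jpartial Xvar F p +
     (\<Sum>(i, j) \<in> {(i, j). jpartial (Uvar i j) F p \<noteq> 0}.
        p (Uvar i (Suc j)) * jpartial (Uvar i j) F p)"

definition partial_t :: "(real \<Rightarrow> real \<Rightarrow> real) \<Rightarrow> real \<Rightarrow> real \<Rightarrow> real" where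
  "partial_t u t x = deriv (\<lambda>s. u s x) t"

definition partial_x :: "(real \<Rightarrow> real \<Rightarrow> real) \<Rightarrow> real \<Rightarrow> real \<Rightarrow> real" where
  "partial_x u t x = deriv (\<lambda>s. u t s) x"

text \<open>Meant for open \<open>D\<close> only, since the partial derivatives are two-sided.\<close>

coinductive smooth_on_plane :: "(real \<times> real) set \<Rightarrow> (real \<Rightarrow> real \<Rightarrow> real) \<Rightarrow> bool"
  for D where
  "\<lbrakk> continuous_on D (\<lambda>(t, x). u t x);
     \<And>t x. (t, x) \<in> D \<Longrightarrow> (\<lambda>s. u s x) differentiable (at t);
     \<And>t x. (t, x) \<in> D \<Longrightarrow> (\<lambda>s. u t s) differentiable (at x);
     smooth_on_plane D (partial_t u);
     smooth_on_plane D (partial_x u) \<rbrakk> \<Longrightarrow> smooth_on_plane D u"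

definition jet_of :: "(real \<Rightarrow> real \<Rightarrow> real) \<Rightarrow> real \<Rightarrow> real \<Rightarrow> jet" where
  "jet_of u t x = (\<lambda>v. case v of
      Tvar \<Rightarrow> t
    | Xvar \<Rightarrow> x
    | Uvar i j \<Rightarrow> (partial_t ^^ i) ((partial_x ^^ j) u) t x)"

definition solution_on :: "(jet \<Rightarrow> real) \<Rightarrow> (real \<times> real) set \<Rightarrow> (real \<Rightarrow> real \<Rightarrow> real) \<Rightarrow> bool" where
  "solution_on E D u \<longleftrightarrow> smooth_on_plane D u \<and> (\<forall>(t, x)\<in>D. E (jet_of u t x) = 0)"

text \<open>Local solutions, on arbitrary open subsets of the plane, are included.\<close>

definition conserved_current ::
  "(jet \<Rightarrow> real) \<Rightarrow> (jet \<Rightarrow> real) \<Rightarrow> (jet \<Rightarrow> real) \<Rightarrow> bool" where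
  "conserved_current E C0 C1 \<longleftrightarrow>
     differential_function C0 \<and> differential_function C1 \<and>
     (\<forall>D u. open D \<longrightarrow> solution_on E D u \<longrightarrow>
        (\<forall>(t, x)\<in>D. total_t C0 (jet_of u t x) + total_x C1 (jet_of u t x) = 0))"

definition characteristic_of_order :: "nat \<Rightarrow> (jet \<Rightarrow> real) \<Rightarrow> (jet \<Rightarrow> real) \<Rightarrow> bool" where
  "characteristic_of_order m E Q \<longleftrightarrow>
     differential_function_of_order m Q \<and>
     (\<exists>C0 C1. conserved_current E C0 C1 \<and>
        (\<forall>D u. open D \<longrightarrow> smooth_on_plane D u \<longrightarrow>
           (\<forall>(t, x)\<in>D. total_t C0 (jet_of u t x) + total_x C1 (jet_of u t x)
                        = Q (jet_of u t x) * E (jet_of u t x))))"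

definition on_jets :: "(real \<Rightarrow> real \<Rightarrow> real \<Rightarrow> real) \<Rightarrow> jet \<Rightarrow> real" where
  "on_jets Q p = Q (p Tvar) (p Xvar) (p (Uvar 0 0))"

text \<open>
  For \<open>n = 1\<close> the exponent \<open>n - 2\<close> truncates to \<open>0\<close>, which is harmless because the
  coefficient of that term is then \<open>0\<close>.
\<close>

definition E_eq :: "nat \<Rightarrow> jet \<Rightarrow> real" where
  "E_eq n p =
    (let u = p (Uvar 0 0); u_t = p (Uvar 1 0); u_x = p (Uvar 0 1);
         u_xx = p (Uvar 0 2); u_xxx = p (Uvar 0 3); u_txx = p (Uvar 1 2)
     in u_t - u_txx
        + (real n + 1) * (real n + 2) / 2 * u ^ n * u_x
        - real n * (real n - 1) / 2 * u ^ (n - 2) * u_x ^ 3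
        - 2 * real n * u ^ (n - 1) * u_x * u_xx
        - u ^ n * u_xxx)"

end

theory Submission
  imports Defs
begin

text \<open>
  If \<open>Q E\<close> is a divergence, its integral over a rectangle depends only on the jet of \<open>u\<close> on the
  boundary.  Replacing \<open>u\<close> by \<open>u + \<epsilon> \<phi>\<close> with \<open>\<phi>\<close> vanishing to high order on the boundary,
  differentiating at \<open>\<epsilon> = 0\<close> and integrating by parts gives \<open>\<integral> \<phi> W = 0\<close>, where \<open>W\<close> is the
  Euler-Lagrange expression of \<open>Q E\<close> along \<open>u\<close>; as \<open>\<phi>\<close> can be taken positive in the interior of
  arbitrarily small rectangles, \<open>W = 0\<close>.  It suffices to test polynomials \<open>u\<close> of degree two
  with \<open>u\<^sub>x = 0\<close> at the point considered.  Comparing coefficients of the free jet coordinates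
  yields \<open>Q\<^sub>u\<^sub>u = 0\<close>, \<open>Q\<^sub>x\<^sub>u = 0\<close>, \<open>Q\<^sub>t\<^sub>u + n u\<^sup>n\<^sup>-\<^sup>1 Q\<^sub>x = 0\<close> and a fourth equation free of \<open>Q\<^sub>u\<close>,
  which together force \<open>Q\<close> to be affine in \<open>u\<close> with constant coefficients.  Conversely, both
  currents are explicit.
\<close>

section \<open>Calculus on the jet space\<close>

lemma jsmoothD:
  assumes "jsmooth F"
  shows "continuous_on UNIV F"
    and "(\<lambda>s. F (p(v := s))) differentiable (at (p v))"
    and "jsmooth (jpartial v F)"
  using assms by (auto elim: jsmooth.cases)

lemma has_real_derivative_jpartial:
  assumes "jsmooth F"
  shows "((\<lambda>s. F (p(v := s))) has_real_derivative jpartial v F (p(v := s))) (at s)"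
  using jsmoothD(2)[OF assms, of "p(v := s)" v]
  by (simp add: jpartial_def DERIV_deriv_iff_real_differentiable)

lemma jpartialI:
  assumes "((\<lambda>s. F (p(v := s))) has_real_derivative D) (at (p v))"
  shows "jpartial v F p = D"
  unfolding jpartial_def using assms by (rule DERIV_imp_deriv)

lemma depends_only_onD:
  assumes "depends_only_on F S" "\<And>v. v \<in> S \<Longrightarrow> p v = q v"
  shows "F p = F q"
  using assms unfolding depends_only_on_def by blast

lemma depends_only_on_jpartial:
  assumes "depends_only_on F S"
  shows "depends_only_on (jpartial v F) S"
  unfolding depends_only_on_def
proof (intro allI impI)
  fix p q :: jet assume eq: "\<forall>v\<in>S. p v = q v"
  show "jpartial v F p = jpartial v F q"
  proof (cases "v \<in> S")
    case True
    have "F (p(v := s)) = F (q(v := s))" for s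
      using eq by (intro depends_only_onD[OF assms]) auto
    then show ?thesis using True eq by (simp add: jpartial_def)
  next
    case False
    have "F (p(v := s)) = F p" "F (q(v := s)) = F p" for s
      using eq False by (auto intro!: depends_only_onD[OF assms])
    then show ?thesis by (simp add: jpartial_def)
  qed
qed

lemma jpartial_eq_0:
  assumes "depends_only_on F S" "v \<notin> S"
  shows "jpartial v F p = 0"
proof (rule jpartialI)
  have "F (p(v := s)) = F p" for s
    using assms(2) by (intro depends_only_onD[OF assms(1)]) auto
  then show "((\<lambda>s. F (p(v := s))) has_real_derivative 0) (at (p v))" by simp
qed

text \<open>Only partial derivatives of \<open>F\<close> are given, so the coordinates are released
  one at a time: with \<open>v\<close> as a second variable \<open>y\<close>, the induction
  hypothesis differentiates along the curve whose \<open>v\<close>-coordinate is frozen, and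
  continuity of the partial derivative in \<open>v\<close> makes the function of
  \<open>(r, y)\<close> differentiable.\<close>

lemma jet_chain_rule_aux:
  assumes "finite S" "jsmooth F"
    and "\<And>v s. v \<in> S \<Longrightarrow> ((\<lambda>s. \<gamma> s v) has_real_derivative \<gamma>' s v) (at s)"
    and "\<And>v s s'. v \<notin> S \<Longrightarrow> \<gamma> s v = \<gamma> s' v"
  shows "((\<lambda>s. F (\<gamma> s)) has_real_derivative (\<Sum>v\<in>S. \<gamma>' s v * jpartial v F (\<gamma> s))) (at s)"
  using assms(1,3,4)
proof (induction S arbitrary: \<gamma> s rule: finite_induct)
  case empty
  have eq: "\<gamma> r = \<gamma> s" for r
    using empty(2) by (intro ext) simp
  have "(\<lambda>r. F (\<gamma> r)) = (\<lambda>_. F (\<gamma> s))"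
    by (rule ext) (metis eq)
  then show ?case by simp
next
  case (insert v S)
  define H where "H = (\<lambda>r y. F ((\<gamma> r)(v := y)))"
  define D where "D = (\<Sum>w\<in>S. \<gamma>' s w * jpartial w F (\<gamma> s))"
  define Dv where "Dv = (\<lambda>r y. jpartial v F ((\<gamma> r)(v := y)))"
  have "((\<lambda>r. H r (\<gamma> s v)) has_real_derivative
      (\<Sum>w\<in>S. \<gamma>' s w * jpartial w F ((\<gamma> s)(v := \<gamma> s v)))) (at s)"
    unfolding H_def
  proof (rule insert.IH)
    show "((\<lambda>r. ((\<gamma> r)(v := \<gamma> s v)) w) has_real_derivative \<gamma>' r w) (at r)" if "w \<in> S" for w r
      using insert.prems(1)[of w r] that insert.hyps(2) by (cases "w = v") auto
    show "((\<gamma> r)(v := \<gamma> s v)) w = ((\<gamma> r')(v := \<gamma> s v)) w" if "w \<notin> S" for w r r'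
      using insert.prems(2)[of w r r'] that by (cases "w = v") auto
  qed
  then have Hr: "((\<lambda>r. H r (\<gamma> s v)) has_derivative (\<lambda>h. h * D)) (at s)"
    by (simp add: D_def has_field_derivative_def mult_commute_abs)
  have Hy: "((\<lambda>y. H r y) has_derivative blinfun_apply (blinfun_mult_right (Dv r y))) (at y)" for r y
    using has_real_derivative_jpartial[OF assms(2), of "\<gamma> r" v y]
    by (simp add: H_def Dv_def has_field_derivative_def blinfun_mult_right.rep_eq)
  have cont: "continuous_on UNIV (\<lambda>z. Dv (fst z) (snd z))"
  proof -
    have "continuous_on UNIV (\<lambda>z. ((\<gamma> (fst z))(v := snd z)) w)" for w
    proof (cases "w = v \<or> w \<notin> insert v S")
      case True
      then show ?thesis
      proof
        assume "w = v" then show ?thesis by (auto intro!: continuous_intros)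
      next
        assume w: "w \<notin> insert v S"
        then have "((\<gamma> (fst z))(v := snd z)) w = \<gamma> 0 w" for z
          using insert.prems(2)[OF w, of "fst z" 0] by simp
        then show ?thesis by simp
      qed
    next
      case False
      have "continuous_on UNIV (\<lambda>r. \<gamma> r w)"
        using insert.prems(1)[of w] False
        by (auto intro!: DERIV_continuous continuous_at_imp_continuous_on)
      then have "continuous_on UNIV (\<lambda>z. \<gamma> (fst z) w)"
        by (rule continuous_on_compose2) (auto intro!: continuous_intros)
      then show ?thesis using False by simp
    qed
    then show ?thesis unfolding Dv_def
      by (intro continuous_on_compose2[OF jsmoothD(1)[OF jsmoothD(3)[OF assms(2)]]]
          continuous_on_coordinatewise_then_product) auto
  qed
  \<comment> \<open>One partial derivative at the point and continuity of the other one suffice for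
    joint differentiability, so nothing beyond the induction hypothesis is asked of the
    \<open>r\<close>-direction.\<close>
  have "((\<lambda>(r, y). H r y) has_derivative
      (\<lambda>(tr, ty). tr * D + blinfun_mult_right (Dv s (\<gamma> s v)) ty)) (at (s, \<gamma> s v) within UNIV \<times> UNIV)"
  proof (rule has_derivative_partialsI)
    show "continuous (at (s, \<gamma> s v) within UNIV \<times> UNIV) (\<lambda>(x, y). blinfun_mult_right (Dv x y))"
      using bounded_linear.continuous_on[OF bounded_linear_blinfun_mult_right cont]
      by (auto simp: continuous_on_eq_continuous_at case_prod_unfold)
  qed (use Hr Hy in auto)
  then have H2: "((\<lambda>(r, y). H r y) has_derivative
      (\<lambda>(tr, ty). tr * D + Dv s (\<gamma> s v) * ty)) (at (s, \<gamma> s v))"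
    by (simp add: blinfun_mult_right.rep_eq)
  have "((\<lambda>r. (r, \<gamma> r v)) has_derivative (\<lambda>h. (h, \<gamma>' s v * h))) (at s)"
    using insert.prems(1)[of v s]
    by (auto intro!: derivative_eq_intros simp: has_field_derivative_def)
  from has_derivative_compose[OF this H2]
  have "((\<lambda>r. F (\<gamma> r)) has_derivative (\<lambda>h. h * D + Dv s (\<gamma> s v) * (\<gamma>' s v * h))) (at s)"
    by (simp add: H_def)
  moreover have "(\<lambda>h. h * D + Dv s (\<gamma> s v) * (\<gamma>' s v * h)) = (*) (\<gamma>' s v * Dv s (\<gamma> s v) + D)"
    by (simp add: fun_eq_iff algebra_simps)
  ultimately show ?case
    using insert.hyps by (simp add: has_field_derivative_def D_def Dv_def)
qed

text \<open>Coordinates of the curve outside \<open>S\<close> may vary arbitrarily here. Replacing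
  them by 0 gives a curve to which the previous lemma applies, and neither \<open>F\<close> nor its
  partial derivatives notice the change.\<close>

lemma jet_chain_rule:
  assumes "finite S" "jsmooth F" "depends_only_on F S"
    and "\<And>v s. v \<in> S \<Longrightarrow> ((\<lambda>s. \<gamma> s v) has_real_derivative \<gamma>' s v) (at s)"
  shows "((\<lambda>s. F (\<gamma> s)) has_real_derivative (\<Sum>v\<in>S. \<gamma>' s v * jpartial v F (\<gamma> s))) (at s)"
proof -
  define \<delta> where "\<delta> s v = (if v \<in> S then \<gamma> s v else 0)" for s v
  have "((\<lambda>s. F (\<delta> s)) has_real_derivative (\<Sum>v\<in>S. \<gamma>' s v * jpartial v F (\<delta> s))) (at s)"
    using assms(1,2,4) by (intro jet_chain_rule_aux) (auto simp: \<delta>_def)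
  moreover have eq: "G (\<delta> s) = G (\<gamma> s)" if "depends_only_on G S" for G s
    by (intro depends_only_onD[OF that]) (auto simp: \<delta>_def)
  ultimately show ?thesis
    by (simp only: eq[OF assms(3)] eq[OF depends_only_on_jpartial[OF assms(3)]])
qed

section \<open>Total derivatives as sums over a fixed finite index set\<close>

lemma finite_jvars_upto: "finite (jvars_upto m)"
proof -
  have "{Uvar i j |i j. i + j \<le> m} \<subseteq> (\<lambda>(i, j). Uvar i j) ` ({..m} \<times> {..m})" by auto
  then show ?thesis unfolding jvars_upto_def
    using finite_subset by fastforce
qed

lemma jvars_upto_mono: "m \<le> k \<Longrightarrow> jvars_upto m \<subseteq> jvars_upto k"
  unfolding jvars_upto_def by auto

lemma depends_only_on_mono: "depends_only_on F S \<Longrightarrow> S \<subseteq> T \<Longrightarrow> depends_only_on F T"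
  unfolding depends_only_on_def by blast

lemma sum_jvars_upto:
  "sum h (jvars_upto m) = h Tvar + h Xvar + (\<Sum>(i, j)\<in>{(i, j). i + j \<le> m}. h (Uvar i j))"
proof -
  have eq: "{Uvar i j |i j. i + j \<le> m} = (\<lambda>(i, j). Uvar i j) ` {(i, j). i + j \<le> m}" by auto
  have fin: "finite {(i, j). i + j \<le> (m::nat)}"
    by (rule finite_subset[of _ "{..m} \<times> {..m}"]) auto
  have inj: "inj_on (\<lambda>(i, j). Uvar i j) {(i, j). i + j \<le> m}" by (auto simp: inj_on_def)
  have "sum h (jvars_upto m) = sum h {Tvar, Xvar} + sum h {Uvar i j |i j. i + j \<le> m}"
    unfolding jvars_upto_def
    by (rule sum.union_disjoint) (use fin in \<open>auto simp: eq\<close>)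
  also have "sum h {Uvar i j |i j. i + j \<le> m} = (\<Sum>(i, j)\<in>{(i, j). i + j \<le> m}. h (Uvar i j))"
    unfolding eq sum.reindex[OF inj] by (simp add: case_prod_unfold o_def)
  finally show ?thesis by simp
qed

text \<open>The index set in the definition of \<open>total_t\<close> varies with the point
  \<open>p\<close>. Padding it with zero terms makes it independent of \<open>p\<close> and common
  to all functions of order at most \<open>m\<close>, so that sums can be compared termwise.\<close>

lemma total_t_eq:
  assumes "depends_only_on F (jvars_upto m)"
  shows "total_t F p = jpartial Tvar F p +
     (\<Sum>(i, j)\<in>{(i, j). i + j \<le> m}. p (Uvar (Suc i) j) * jpartial (Uvar i j) F p)"
proof -
  have fin: "finite {(i, j). i + j \<le> (m::nat)}"
    by (rule finite_subset[of _ "{..m} \<times> {..m}"]) auto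
  show ?thesis unfolding total_t_def
    using jpartial_eq_0[OF assms]
    by (intro arg_cong2[where f = "(+)"] refl sum.mono_neutral_left fin)
      (fastforce simp: jvars_upto_def)+
qed

lemma total_x_eq:
  assumes "depends_only_on F (jvars_upto m)"
  shows "total_x F p = jpartial Xvar F p +
     (\<Sum>(i, j)\<in>{(i, j). i + j \<le> m}. p (Uvar i (Suc j)) * jpartial (Uvar i j) F p)"
proof -
  have fin: "finite {(i, j). i + j \<le> (m::nat)}"
    by (rule finite_subset[of _ "{..m} \<times> {..m}"]) auto
  show ?thesis unfolding total_x_def
    using jpartial_eq_0[OF assms]
    by (intro arg_cong2[where f = "(+)"] refl sum.mono_neutral_left fin)
      (fastforce simp: jvars_upto_def)+
qed

section \<open>Jets of polynomials\<close>

text \<open>Sums of products of one-variable polynomials, for which the order of partial derivatives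
  visibly does not matter.\<close>

definition sepsum :: "(real poly \<times> real poly) list \<Rightarrow> real \<Rightarrow> real \<Rightarrow> real" where
  "sepsum L t x = (\<Sum>(f, g)\<leftarrow>L. poly f t * poly g x)"

lemma sepsum_simps [simp]:
  "sepsum [] t x = 0"
  "sepsum ((f, g) # L) t x = poly f t * poly g x + sepsum L t x"
  by (simp_all add: sepsum_def)

lemma sepsum_t_derivative:
  "((\<lambda>s. sepsum L s x) has_real_derivative sepsum (map (apfst pderiv) L) t x) (at t)"
  by (induction L) (auto intro!: derivative_eq_intros simp: fun_eq_iff)

lemma sepsum_x_derivative:
  "((\<lambda>s. sepsum L t s) has_real_derivative sepsum (map (apsnd pderiv) L) t x) (at x)"
proof (induction L)
  case Nil
  have "sepsum [] t = (\<lambda>_. 0)" by (simp add: fun_eq_iff)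
  then show ?case by simp
next
  case (Cons p L)
  have "sepsum (p # L) t = (\<lambda>s. poly (fst p) t * poly (snd p) s + sepsum L t s)"
    by (cases p) (simp add: fun_eq_iff)
  then show ?case
    using Cons by (cases p) (auto intro!: derivative_eq_intros)
qed

lemma partial_t_sepsum: "partial_t (sepsum L) = sepsum (map (apfst pderiv) L)"
  unfolding partial_t_def fun_eq_iff using DERIV_imp_deriv[OF sepsum_t_derivative] by blast

lemma partial_x_sepsum: "partial_x (sepsum L) = sepsum (map (apsnd pderiv) L)"
  unfolding partial_x_def fun_eq_iff using DERIV_imp_deriv[OF sepsum_x_derivative] by blast

lemma continuous_on_sepsum [continuous_intros]:
  "continuous_on A f \<Longrightarrow> continuous_on A g \<Longrightarrow> continuous_on A (\<lambda>z. sepsum L (f z) (g z))"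
  by (induction L) (auto intro!: continuous_intros)

text \<open>The family of all \<open>sepsum L\<close> is closed under both partial derivatives and
  is therefore a coinduction invariant.\<close>

lemma smooth_on_plane_sepsum: "smooth_on_plane D (sepsum L)"
proof (coinduction arbitrary: L)
  case smooth_on_plane
  have "continuous_on D (\<lambda>(t, x). sepsum L t x)"
    unfolding case_prod_unfold by (intro continuous_intros)
  moreover have "(\<lambda>s. sepsum L s x) differentiable at t"
      "(\<lambda>s. sepsum L t s) differentiable at x" for t x
    using sepsum_t_derivative sepsum_x_derivative real_differentiable_def by blast+
  ultimately show ?case
    by (auto simp: partial_t_sepsum partial_x_sepsum)
qed

lemma funpow_partial_x_sepsum:
  "(partial_x ^^ j) (sepsum L) = sepsum (map (apsnd (pderiv ^^ j)) L)"
  by (induction j) (auto simp: partial_x_sepsum o_def apsnd_def map_prod_def intro!: arg_cong[where f = sepsum])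

lemma funpow_partial_t_sepsum:
  "(partial_t ^^ i) (sepsum L) = sepsum (map (apfst (pderiv ^^ i)) L)"
  by (induction i) (auto simp: partial_t_sepsum o_def apfst_def map_prod_def intro!: arg_cong[where f = sepsum])

lemma jet_of_sepsum:
  "jet_of (sepsum L) t x (Uvar i j) = sepsum (map (map_prod (pderiv ^^ i) (pderiv ^^ j)) L) t x"
  by (simp add: jet_of_def funpow_partial_x_sepsum funpow_partial_t_sepsum o_def
      apfst_def apsnd_def map_prod_def case_prod_unfold)

lemma jet_of_simps [simp]: "jet_of u t x Tvar = t" "jet_of u t x Xvar = x"
  by (simp_all add: jet_of_def)

lemma continuous_on_jet_of_sepsum:
  "continuous_on A (\<lambda>(t, x). jet_of (sepsum L) t x v)"
  unfolding case_prod_unfold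
  by (cases v) (auto simp: jet_of_sepsum intro!: continuous_intros)

lemma jet_of_sepsum_t_derivative:
  "((\<lambda>s. jet_of (sepsum L) s x v) has_real_derivative
     (case v of Tvar \<Rightarrow> 1 | Xvar \<Rightarrow> 0 | Uvar i j \<Rightarrow> jet_of (sepsum L) t x (Uvar (Suc i) j))) (at t)"
proof (cases v)
  case (Uvar i j)
  then show ?thesis
    using sepsum_t_derivative[of "map (map_prod (pderiv ^^ i) (pderiv ^^ j)) L" x t]
    by (simp add: jet_of_sepsum o_def apfst_def map_prod_def case_prod_unfold)
qed auto

text \<open>In \<open>jet_of\<close> the derivatives in \<open>x\<close> are taken before those in
  \<open>t\<close>, so this further \<open>x\<close>-derivative has to pass the
  \<open>t\<close>-derivatives. It can, because the two act on different factors of each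
  summand.\<close>

lemma jet_of_sepsum_x_derivative:
  "((\<lambda>s. jet_of (sepsum L) t s v) has_real_derivative
     (case v of Tvar \<Rightarrow> 0 | Xvar \<Rightarrow> 1 | Uvar i j \<Rightarrow> jet_of (sepsum L) t x (Uvar i (Suc j)))) (at x)"
proof (cases v)
  case (Uvar i j)
  then show ?thesis
    using sepsum_x_derivative[of "map (map_prod (pderiv ^^ i) (pderiv ^^ j)) L" t x]
    by (simp add: jet_of_sepsum o_def apsnd_def map_prod_def case_prod_unfold)
qed auto

text \<open>Chain rule along the curve of jets: the velocity is 1 at \<open>Tvar\<close>, 0 at
  \<open>Xvar\<close> and the next derivative of \<open>u\<close> at each \<open>Uvar i j\<close>,
  which are the coefficients in \<open>total_t_eq\<close>.\<close>

lemma total_t_jet: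
  assumes "differential_function_of_order m F"
  shows "((\<lambda>s. F (jet_of (sepsum L) s x)) has_real_derivative
     total_t F (jet_of (sepsum L) t x)) (at t)"
proof -
  have F: "jsmooth F" "depends_only_on F (jvars_upto m)"
    using assms by (auto simp: differential_function_of_order_def)
  show ?thesis
    using jet_chain_rule[OF finite_jvars_upto F, of "\<lambda>s. jet_of (sepsum L) s x", OF jet_of_sepsum_t_derivative]
    by (simp add: sum_jvars_upto total_t_eq[OF F(2)])
qed

lemma total_x_jet:
  assumes "differential_function_of_order m F"
  shows "((\<lambda>s. F (jet_of (sepsum L) t s)) has_real_derivative
     total_x F (jet_of (sepsum L) t x)) (at x)"
proof -
  have F: "jsmooth F" "depends_only_on F (jvars_upto m)"
    using assms by (auto simp: differential_function_of_order_def)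
  show ?thesis
    using jet_chain_rule[OF finite_jvars_upto F, of "\<lambda>s. jet_of (sepsum L) t s", OF jet_of_sepsum_x_derivative]
    by (simp add: sum_jvars_upto total_x_eq[OF F(2)])
qed

lemma continuous_on_jsmooth_jet:
  assumes "jsmooth F"
  shows "continuous_on A (\<lambda>(t, x). F (jet_of (sepsum L) t x))"
  unfolding case_prod_unfold
  using continuous_on_jet_of_sepsum[of A L]
  by (intro continuous_on_compose2[OF jsmoothD(1)[OF assms]]
      continuous_on_coordinatewise_then_product) (auto simp: case_prod_unfold)

lemma continuous_on_total_jet:
  assumes "differential_function_of_order m F"
  shows "continuous_on A (\<lambda>(t, x). total_t F (jet_of (sepsum L) t x))"
    and "continuous_on A (\<lambda>(t, x). total_x F (jet_of (sepsum L) t x))"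
proof -
  have F: "jsmooth F" "depends_only_on F (jvars_upto m)"
    using assms by (auto simp: differential_function_of_order_def)
  note c = continuous_on_jsmooth_jet[OF jsmoothD(3)[OF F(1)], unfolded case_prod_unfold]
    continuous_on_jet_of_sepsum[unfolded case_prod_unfold]
  show "continuous_on A (\<lambda>(t, x). total_t F (jet_of (sepsum L) t x))"
    "continuous_on A (\<lambda>(t, x). total_x F (jet_of (sepsum L) t x))"
    unfolding total_t_eq[OF F(2)] total_x_eq[OF F(2)] case_prod_unfold
    by (intro continuous_intros c)+
qed

section \<open>The algebra of smooth functions\<close>

text \<open>Being closed under partial derivatives, this algebra is a coinduction invariant for
  \<open>jsmooth\<close>.\<close>

inductive_set jalgebra :: "(jet \<Rightarrow> real) set" where
  smooth: "jsmooth F \<Longrightarrow> F \<in> jalgebra"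
| const: "(\<lambda>_. c) \<in> jalgebra"
| coord: "(\<lambda>p. p v) \<in> jalgebra"
| add: "F \<in> jalgebra \<Longrightarrow> G \<in> jalgebra \<Longrightarrow> (\<lambda>p. F p + G p) \<in> jalgebra"
| mult: "F \<in> jalgebra \<Longrightarrow> G \<in> jalgebra \<Longrightarrow> (\<lambda>p. F p * G p) \<in> jalgebra"

lemma jpartial_const [simp]: "jpartial v (\<lambda>_. c) p = 0"
  by (simp add: jpartial_def)

lemma jpartial_coord: "jpartial v (\<lambda>p. p w) p = (if v = w then 1 else 0)"
  by (rule jpartialI) (auto intro!: derivative_eq_intros)

lemma jalgebra_diff:
  assumes "F \<in> jalgebra"
  shows "((\<lambda>s. F (p(v := s))) has_real_derivative jpartial v F p) (at (p v))"
  using assms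
proof (induction arbitrary: p)
  case (smooth F)
  then show ?case using has_real_derivative_jpartial[of F p v "p v"] by (simp only: fun_upd_triv)
next
  case (const c)
  then show ?case by simp
next
  case (coord w)
  then show ?case by (auto simp: jpartial_coord intro!: derivative_eq_intros)
next
  case (add F G)
  have *: "((\<lambda>s. F (p(v := s)) + G (p(v := s))) has_real_derivative
      jpartial v F p + jpartial v G p) (at (p v))"
    by (intro DERIV_add add.IH)
  show ?case unfolding jpartialI[of "\<lambda>p. F p + G p", OF *] by (rule *)
next
  case (mult F G)
  have *: "((\<lambda>s. F (p(v := s)) * G (p(v := s))) has_real_derivative
      jpartial v F p * G (p(v := p v)) + jpartial v G p * F (p(v := p v))) (at (p v))"
    by (rule DERIV_mult[OF mult.IH])
  show ?case unfolding jpartialI[of "\<lambda>p. F p * G p", OF *] by (rule *)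
qed

lemma jpartial_add:
  assumes "F \<in> jalgebra" "G \<in> jalgebra"
  shows "jpartial v (\<lambda>p. F p + G p) p = jpartial v F p + jpartial v G p"
  using DERIV_add[OF jalgebra_diff[OF assms(1), of p v] jalgebra_diff[OF assms(2), of p v]]
  by (intro jpartialI) simp

lemma jpartial_mult:
  assumes "F \<in> jalgebra" "G \<in> jalgebra"
  shows "jpartial v (\<lambda>p. F p * G p) p = jpartial v F p * G p + F p * jpartial v G p"
  using DERIV_mult[OF jalgebra_diff[OF assms(1), of p v] jalgebra_diff[OF assms(2), of p v]]
  by (intro jpartialI) (simp add: mult.commute)

lemma jpartial_jalgebra:
  assumes "F \<in> jalgebra"
  shows "jpartial v F \<in> jalgebra"
  using assms
proof induction
  case (smooth F)
  then show ?case using jsmoothD(3) jalgebra.smooth by blast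
next
  case (const c)
  have "jpartial v (\<lambda>_. c) = (\<lambda>_. 0)" by (simp add: fun_eq_iff)
  then show ?case using jalgebra.const by metis
next
  case (coord w)
  have "jpartial v (\<lambda>p. p w) = (\<lambda>_. if v = w then 1 else 0)" by (simp add: fun_eq_iff jpartial_coord)
  then show ?case using jalgebra.const by metis
next
  case (add F G)
  have "jpartial v (\<lambda>p. F p + G p) = (\<lambda>p. jpartial v F p + jpartial v G p)"
    using jpartial_add[OF add.hyps] by (simp add: fun_eq_iff)
  then show ?case using jalgebra.add[OF add.IH] by metis
next
  case (mult F G)
  have "jpartial v (\<lambda>p. F p * G p) = (\<lambda>p. jpartial v F p * G p + F p * jpartial v G p)"
    using jpartial_mult[OF mult.hyps] by (simp add: fun_eq_iff)
  then show ?case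
    using jalgebra.add[OF jalgebra.mult[OF mult.IH(1) mult.hyps(2)] jalgebra.mult[OF mult.hyps(1) mult.IH(2)]]
    by metis
qed

lemma jalgebra_continuous:
  assumes "F \<in> jalgebra"
  shows "continuous_on UNIV F"
  using assms
  by induction (auto intro!: continuous_intros continuous_on_product_then_coordinatewise[of _ "\<lambda>p. p"]
      dest: jsmoothD(1))

lemma jalgebra_jsmooth:
  assumes "F \<in> jalgebra"
  shows "jsmooth F"
  using assms
proof (coinduction arbitrary: F)
  case jsmooth
  have "(\<lambda>s. F (p(v := s))) differentiable at (p v)" for p v
    using jalgebra_diff[OF jsmooth, of p v] real_differentiable_def by blast
  then show ?case
    using jalgebra_continuous[OF jsmooth] jpartial_jalgebra[OF jsmooth] by blast
qed

lemma jalgebra_iff: "F \<in> jalgebra \<longleftrightarrow> jsmooth F"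
  using jalgebra_jsmooth jalgebra.smooth by blast

lemma jsmooth_const: "jsmooth (\<lambda>_. c)"
  and jsmooth_coord: "jsmooth (\<lambda>p. p v)"
  and jsmooth_add: "jsmooth F \<Longrightarrow> jsmooth G \<Longrightarrow> jsmooth (\<lambda>p. F p + G p)"
  and jsmooth_mult: "jsmooth F \<Longrightarrow> jsmooth G \<Longrightarrow> jsmooth (\<lambda>p. F p * G p)"
  using jalgebra.const jalgebra.coord jalgebra.add jalgebra.mult by (auto simp: jalgebra_iff)

lemma jsmooth_diff: "jsmooth F \<Longrightarrow> jsmooth G \<Longrightarrow> jsmooth (\<lambda>p. F p - G p)"
  using jsmooth_add[of F "\<lambda>p. (- 1) * G p"] jsmooth_mult[OF jsmooth_const[of "- 1"], of G] by simp

lemma jsmooth_power: "jsmooth F \<Longrightarrow> jsmooth (\<lambda>p. F p ^ k)"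
  by (induction k) (auto intro: jsmooth_const jsmooth_mult)

lemmas jsmooth_intros = jsmooth_const jsmooth_coord jsmooth_add jsmooth_diff jsmooth_mult jsmooth_power

section \<open>Variation of the integral over a rectangle\<close>

text \<open>By Fubini the integral over \<open>t\<close> can be done first, and by the fundamental
  theorem of calculus it leaves only the difference of the two boundary values.\<close>

lemma integral_t_derivative_eq_0:
  fixes A A' :: "real \<Rightarrow> real \<Rightarrow> real"
  assumes "a \<le> b"
    and "\<And>t x. ((\<lambda>s. A s x) has_real_derivative A' t x) (at t)"
    and "continuous_on (cbox (a, c) (b, d)) (\<lambda>(t, x). A' t x)"
    and "\<And>x. A a x = 0" "\<And>x. A b x = 0"
  shows "integral (cbox (a, c) (b, d)) (\<lambda>(t, x). A' t x) = 0"
proof -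
  have "integral (cbox (a, c) (b, d)) (\<lambda>(t, x). A' t x)
      = integral (cbox c d) (\<lambda>x. integral (cbox a b) (\<lambda>t. A' t x))"
    using integral_prod_continuous[OF assms(3)] integral_swap_continuous[OF assms(3)] by simp
  moreover have "integral (cbox a b) (\<lambda>t. A' t x) = 0" for x
    using fundamental_theorem_of_calculus[OF assms(1), of "\<lambda>t. A t x" "\<lambda>t. A' t x"] assms(2,4,5)
    by (simp add: integral_unique has_real_derivative_iff_has_vector_derivative
        has_vector_derivative_at_within)
  ultimately show ?thesis by simp
qed

lemma integral_x_derivative_eq_0:
  fixes A A' :: "real \<Rightarrow> real \<Rightarrow> real"
  assumes "c \<le> d"
    and "\<And>t x. ((\<lambda>s. A t s) has_real_derivative A' t x) (at x)"
    and "continuous_on (cbox (a, c) (b, d)) (\<lambda>(t, x). A' t x)"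
    and "\<And>t. A t c = 0" "\<And>t. A t d = 0"
  shows "integral (cbox (a, c) (b, d)) (\<lambda>(t, x). A' t x) = 0"
proof -
  have "integral (cbox (a, c) (b, d)) (\<lambda>(t, x). A' t x)
      = integral (cbox a b) (\<lambda>t. integral (cbox c d) (\<lambda>x. A' t x))"
    using integral_prod_continuous[OF assms(3)] by simp
  moreover have "integral (cbox c d) (\<lambda>x. A' t x) = 0" for t
    using fundamental_theorem_of_calculus[OF assms(1), of "\<lambda>x. A t x" "\<lambda>x. A' t x"] assms(2,4,5)
    by (simp add: integral_unique has_real_derivative_iff_has_vector_derivative
        has_vector_derivative_at_within)
  ultimately show ?thesis by simp
qed

lemma integral_divergence_eq_0:
  fixes A A' B B' :: "real \<Rightarrow> real \<Rightarrow> real"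
  assumes "a \<le> b" "c \<le> d"
    and "\<And>t x. ((\<lambda>s. A s x) has_real_derivative A' t x) (at t)"
    and "\<And>t x. ((\<lambda>s. B t s) has_real_derivative B' t x) (at x)"
    and "continuous_on (cbox (a, c) (b, d)) (\<lambda>(t, x). A' t x)"
    and "continuous_on (cbox (a, c) (b, d)) (\<lambda>(t, x). B' t x)"
    and "\<And>x. A a x = 0" "\<And>x. A b x = 0" "\<And>t. B t c = 0" "\<And>t. B t d = 0"
  shows "integral (cbox (a, c) (b, d)) (\<lambda>(t, x). A' t x + B' t x) = 0"
proof -
  have "integral (cbox (a, c) (b, d)) (\<lambda>z. (\<lambda>(t, x). A' t x) z + (\<lambda>(t, x). B' t x) z) = 0"
    using integral_t_derivative_eq_0[OF assms(1,3,5,7,8)] integral_x_derivative_eq_0[OF assms(2,4,6,9,10)]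
    by (subst integral_add) (auto intro!: integrable_continuous assms)
  then show ?thesis by (simp add: case_prod_unfold)
qed

text \<open>The currents along \<open>L\<close> and \<open>M\<close> agree on the boundary because
  they see only jets of order at most \<open>m\<close>. Hence their difference is a field vanishing
  there, and its divergence integrates to zero.\<close>

lemma integral_eq_if_divergence:
  assumes "differential_function_of_order m C0" "differential_function_of_order m C1"
    and div: "\<And>L t x. total_t C0 (jet_of (sepsum L) t x) + total_x C1 (jet_of (sepsum L) t x)
                  = H (jet_of (sepsum L) t x)"
    and "a \<le> b" "c \<le> d"
    and bd: "\<And>v x t. v \<in> jvars_upto m \<Longrightarrow> t \<in> {a, b} \<or> x \<in> {c, d} \<Longrightarrow>
           jet_of (sepsum L) t x v = jet_of (sepsum M) t x v"
    and "jsmooth H"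
  shows "integral (cbox (a, c) (b, d)) (\<lambda>(t, x). H (jet_of (sepsum L) t x))
       = integral (cbox (a, c) (b, d)) (\<lambda>(t, x). H (jet_of (sepsum M) t x))"
proof -
  let ?J = "\<lambda>L t x. jet_of (sepsum L) t x"
  have eq: "C (?J L t x) = C (?J M t x)"
    if "differential_function_of_order m C" "t \<in> {a, b} \<or> x \<in> {c, d}" for C t x
    using depends_only_onD[of C "jvars_upto m" "?J L t x" "?J M t x"] that bd
    by (auto simp: differential_function_of_order_def)
  note cont = continuous_on_total_jet[unfolded case_prod_unfold]
  have "integral (cbox (a, c) (b, d)) (\<lambda>(t, x). (total_t C0 (?J L t x) - total_t C0 (?J M t x))
       + (total_x C1 (?J L t x) - total_x C1 (?J M t x))) = 0"
  proof (rule integral_divergence_eq_0)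
    show "((\<lambda>s. C0 (?J L s x) - C0 (?J M s x)) has_real_derivative
        (total_t C0 (?J L t x) - total_t C0 (?J M t x))) (at t)" for t x
      by (intro DERIV_diff total_t_jet[OF assms(1)])
    show "((\<lambda>s. C1 (?J L t s) - C1 (?J M t s)) has_real_derivative
        (total_x C1 (?J L t x) - total_x C1 (?J M t x))) (at x)" for t x
      by (intro DERIV_diff total_x_jet[OF assms(2)])
  qed (use assms(4,5) in \<open>auto intro!: eq assms(1,2) continuous_intros cont[OF assms(1)] cont[OF assms(2)]
         simp: case_prod_unfold\<close>)
  then have "integral (cbox (a, c) (b, d)) (\<lambda>(t, x). H (?J L t x) - H (?J M t x)) = 0"
    by (simp add: div[symmetric] algebra_simps)
  then have "integral (cbox (a, c) (b, d))
      (\<lambda>z. (\<lambda>(t, x). H (?J L t x)) z - (\<lambda>(t, x). H (?J M t x)) z) = 0"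
    by (simp add: case_prod_unfold)
  then show ?thesis
    by (subst (asm) integral_diff)
      (auto intro!: integrable_continuous continuous_on_jsmooth_jet assms(7))
qed

section \<open>Polynomial test functions and the first variation\<close>

lemma power_dvd_pderiv:
  fixes p q :: "real poly"
  assumes "p ^ Suc k dvd q"
  shows "p ^ k dvd pderiv q"
proof -
  obtain r where "q = p ^ Suc k * r" using assms by (auto elim: dvdE)
  then have "pderiv q = p ^ k * (p * pderiv r + smult (of_nat (Suc k)) (pderiv p * r))"
    by (simp only: pderiv_mult pderiv_power_Suc) (simp add: algebra_simps)
  then show ?thesis by simp
qed

text \<open>Each differentiation costs at most one factor \<open>p\<close>, so after fewer than
  \<open>N\<close> of them at least one factor is left to vanish at \<open>a\<close>.\<close>

lemma poly_funpow_pderiv_power_eq_0: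
  fixes p :: "real poly"
  assumes "poly p a = 0" "i < N"
  shows "poly ((pderiv ^^ i) (p ^ N)) a = 0"
proof -
  have "p ^ (N - i) dvd (pderiv ^^ i) (p ^ N)" if "i < N" for i
    using that
  proof (induction i)
    case (Suc i)
    then have "p ^ Suc (N - Suc i) dvd (pderiv ^^ i) (p ^ N)" by (simp add: Suc_diff_Suc)
    from power_dvd_pderiv[OF this] show ?case by simp
  qed simp
  from this[OF assms(2)] obtain r where "(pderiv ^^ i) (p ^ N) = p ^ (N - i) * r" by (auto elim: dvdE)
  then show ?thesis using assms by simp
qed

text \<open>This replaces a compactly supported test function: it is positive inside the interval
  and has zeros of order \<open>N\<close> at the ends when \<open>a\<close> and \<open>b\<close>
  differ. Being a polynomial, it keeps the perturbed \<open>u\<close> within the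
  \<open>sepsum\<close> class.\<close>

definition bump :: "nat \<Rightarrow> real \<Rightarrow> real \<Rightarrow> real poly" where
  "bump N a b = ([:- a, 1:] * [:b, - 1:]) ^ N"

lemma bump_endpoints:
  assumes "i < N" "s \<in> {a, b}"
  shows "poly ((pderiv ^^ i) (bump N a b)) s = 0"
  unfolding bump_def using assms by (intro poly_funpow_pderiv_power_eq_0) auto

lemma bump_pos: "a < s \<Longrightarrow> s < b \<Longrightarrow> poly (bump N a b) s > 0"
proof -
  assume "a < s" "s < b"
  moreover have "poly (bump N a b) s = ((s - a) * (b - s)) ^ N"
    unfolding bump_def poly_power by (simp add: algebra_simps)
  ultimately show ?thesis by simp
qed

lemma funpow_pderiv_smult: "(pderiv ^^ i) (smult e f) = smult e ((pderiv ^^ i) f)"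
  by (induction i) (auto simp: pderiv_smult)

text \<open>Perturbing \<open>u\<close> by \<open>e\<close> times the product of two bumps leaves
  its jet of order \<open>m\<close> on the boundary unchanged, since \<open>m < N\<close>. The
  integral of \<open>H\<close> is then constant in \<open>e\<close>, and its derivative at
  \<open>e = 0\<close> is the integral of the linearization of \<open>H\<close>; the
  \<open>case\<close> expression is the jet of the perturbation.\<close>

lemma first_variation:
  assumes C: "differential_function_of_order m C0" "differential_function_of_order m C1"
    and div: "\<And>L t x. total_t C0 (jet_of (sepsum L) t x) + total_x C1 (jet_of (sepsum L) t x)
                  = H (jet_of (sepsum L) t x)"
    and "a \<le> b" "c \<le> d"
    and H: "jsmooth H" "depends_only_on H S" and S: "finite S"
    and "m < N"
  shows "integral (cbox (a, c) (b, d)) (\<lambda>(t, x). \<Sum>v\<in>S. (case v of Tvar \<Rightarrow> 0 | Xvar \<Rightarrow> 0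
      | Uvar i j \<Rightarrow> poly ((pderiv ^^ i) (bump N a b)) t * poly ((pderiv ^^ j) (bump N c d)) x)
      * jpartial v H (jet_of (sepsum L) t x)) = 0"
proof -
  define \<phi> where "\<phi> = (\<lambda>v t x. case v of Tvar \<Rightarrow> 0 | Xvar \<Rightarrow> 0
      | Uvar i j \<Rightarrow> poly ((pderiv ^^ i) (bump N a b)) t * poly ((pderiv ^^ j) (bump N c d)) x)"
  define M where "M e = (smult e (bump N a b), bump N c d) # L" for e
  have jet: "jet_of (sepsum (M e)) t x v = jet_of (sepsum L) t x v + e * \<phi> v t x" for e t x v
    by (cases v) (auto simp: M_def jet_of_sepsum \<phi>_def funpow_pderiv_smult algebra_simps)
  have \<phi>_cont: "continuous_on A (\<lambda>z. \<phi> v (f z) (g z))"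
    if "continuous_on A f" "continuous_on A g" for A :: "(real \<times> real \<times> real) set" and f g v
    unfolding \<phi>_def using that by (cases v) (auto intro!: continuous_intros)
  define D where "D = (\<lambda>e z. \<Sum>v\<in>S. \<phi> v (fst z) (snd z) *
      jpartial v H (jet_of (sepsum (M e)) (fst z) (snd z)))"
  have d: "((\<lambda>e. jet_of (sepsum (M e)) t x v) has_real_derivative \<phi> v t x) (at e)" for e t x v
    unfolding jet by (auto intro!: derivative_eq_intros)
  have deriv: "((\<lambda>e. (\<lambda>(t, x). H (jet_of (sepsum (M e)) t x)) z) has_field_derivative D e z) (at e within UNIV)" for e z
    using jet_chain_rule[OF S H, of "\<lambda>e. jet_of (sepsum (M e)) (fst z) (snd z)" "\<lambda>_ v. \<phi> v (fst z) (snd z)" e, OF d]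
    unfolding D_def case_prod_unfold .
  have Jcont: "continuous_on (UNIV \<times> cbox (a, c) (b, d))
      (\<lambda>(e, z). jet_of (sepsum (M e)) (fst z) (snd z) v)" for v
    unfolding jet case_prod_unfold
    by (intro continuous_intros \<phi>_cont continuous_on_compose2[OF continuous_on_jet_of_sepsum[of UNIV L v, unfolded case_prod_unfold]]) auto
  \<comment> \<open>Differentiation under the integral sign; \<open>D 0\<close> is the linearized
    integrand.\<close>
  have "((\<lambda>e. integral (cbox (a, c) (b, d)) (\<lambda>(t, x). H (jet_of (sepsum (M e)) t x)))
      has_field_derivative integral (cbox (a, c) (b, d)) (D 0)) (at 0 within UNIV)"
  proof (rule leibniz_rule_field_derivative[OF deriv])
    show "continuous_on (UNIV \<times> cbox (a, c) (b, d)) (\<lambda>(x, t). D x t)"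
      unfolding D_def case_prod_unfold
      using Jcont
      by (intro continuous_intros \<phi>_cont
          continuous_on_compose2[OF jsmoothD(1)[OF jsmoothD(3)[OF H(1)]]]
          continuous_on_coordinatewise_then_product) (auto simp: case_prod_unfold)
  qed (auto intro!: integrable_continuous continuous_on_jsmooth_jet H)
  moreover have "integral (cbox (a, c) (b, d)) (\<lambda>(t, x). H (jet_of (sepsum (M e)) t x))
      = integral (cbox (a, c) (b, d)) (\<lambda>(t, x). H (jet_of (sepsum L) t x))" for e
  proof (rule integral_eq_if_divergence[OF C div])
    show "jet_of (sepsum (M e)) t x v = jet_of (sepsum L) t x v"
      if "v \<in> jvars_upto m" "t \<in> {a, b} \<or> x \<in> {c, d}" for v x t
    proof (cases v)
      case (Uvar i j)
      then have "i < N" "j < N" using that(1) \<open>m < N\<close> by (auto simp: jvars_upto_def)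
      then have "\<phi> v t x = 0"
        using bump_endpoints[of i N t a b] bump_endpoints[of j N x c d] that(2)
        by (auto simp: \<phi>_def Uvar)
      then show ?thesis by (simp add: jet)
    qed auto
  qed (use assms in auto)
  ultimately have "((\<lambda>_. integral (cbox (a, c) (b, d)) (\<lambda>(t, x). H (jet_of (sepsum L) t x)))
      has_field_derivative integral (cbox (a, c) (b, d)) (D 0)) (at (0::real))"
    by simp
  then have "integral (cbox (a, c) (b, d)) (D 0) = 0"
    using DERIV_unique DERIV_const by blast
  moreover have "jet_of (sepsum (M 0)) t x = jet_of (sepsum L) t x" for t x
    by (intro ext) (simp add: jet)
  ultimately show ?thesis by (simp add: D_def \<phi>_def case_prod_unfold)
qed

text \<open>If \<open>W\<close> were nonzero at the point, it would keep its sign on a small square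
  around it. The integrand there, up to that sign, would be continuous, nonnegative and positive at
  the centre, and could not integrate to zero.\<close>

lemma fundamental_lemma_of_variations:
  fixes W :: "real \<Rightarrow> real \<Rightarrow> real"
  assumes cont: "continuous_on UNIV (\<lambda>(t, x). W t x)"
    and int: "\<And>a b c d. a < t0 \<Longrightarrow> t0 < b \<Longrightarrow> c < x0 \<Longrightarrow> x0 < d \<Longrightarrow>
      integral (cbox (a, c) (b, d)) (\<lambda>(t, x). poly (bump N a b) t * poly (bump N c d) x * W t x) = 0"
  shows "W t0 x0 = 0"
proof (rule ccontr)
  assume ne: "W t0 x0 \<noteq> 0"
  \<comment> \<open>The sign factor reduces both cases to that of a positive value.\<close>
  define V where "V = (\<lambda>z. sgn (W t0 x0) * W (fst z) (snd z))"
  have Vc: "continuous_on UNIV V"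
    unfolding V_def using cont by (auto intro!: continuous_intros simp: case_prod_unfold)
  have "V (t0, x0) > 0" using ne by (simp add: V_def sgn_real_def)
  moreover have "isCont V (t0, x0)"
    using Vc continuous_on_eq_continuous_at open_UNIV by blast
  ultimately have "eventually (\<lambda>z. V z > 0) (nhds (t0, x0))"
    using order_tendstoD(1) isContD tendsto_at_iff_tendsto_nhds[of V "(t0, x0)"] by blast
  then obtain e where e: "e > 0" "\<And>z. dist z (t0, x0) < e \<Longrightarrow> V z > 0"
    unfolding eventually_nhds_metric by blast
  \<comment> \<open>Points of the square with half side \<open>\<delta>\<close> are at distance at
    most \<open>2 * \<delta>\<close> from the centre, which is less than \<open>e\<close>.\<close>
  define \<delta> where "\<delta> = e / 3"
  have V: "V z > 0" if "z \<in> cbox (t0 - \<delta>, x0 - \<delta>) (t0 + \<delta>, x0 + \<delta>)" for z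
  proof (rule e(2))
    have "\<bar>fst z - t0\<bar> \<le> \<delta>" "\<bar>snd z - x0\<bar> \<le> \<delta>" using that by (auto simp: cbox_prod box_prod)
    then have "dist z (t0, x0) \<le> \<delta> + \<delta>"
      using sqrt_sum_squares_le_sum_abs[of "fst z - t0" "snd z - x0"]
      by (simp add: dist_prod_def dist_real_def)
    then show "dist z (t0, x0) < e" using e(1) by (simp add: \<delta>_def)
  qed
  define f where "f = (\<lambda>z. poly (bump N (t0 - \<delta>) (t0 + \<delta>)) (fst z) *
    poly (bump N (x0 - \<delta>) (x0 + \<delta>)) (snd z) * V z)"
  have fc: "continuous_on (cbox (t0 - \<delta>, x0 - \<delta>) (t0 + \<delta>, x0 + \<delta>)) f"
    unfolding f_def by (intro continuous_intros continuous_on_subset[OF Vc]) auto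
  have "\<delta> > 0" using e by (simp add: \<delta>_def)
  have "integral (cbox (t0 - \<delta>, x0 - \<delta>) (t0 + \<delta>, x0 + \<delta>)) (\<lambda>z. sgn (W t0 x0) *
     (\<lambda>(t, x). poly (bump N (t0 - \<delta>) (t0 + \<delta>)) t * poly (bump N (x0 - \<delta>) (x0 + \<delta>)) x * W t x) z) = 0"
    unfolding integral_mult_right using int[of "t0 - \<delta>" "t0 + \<delta>" "x0 - \<delta>" "x0 + \<delta>"] \<open>\<delta> > 0\<close> by simp
  then have "integral (cbox (t0 - \<delta>, x0 - \<delta>) (t0 + \<delta>, x0 + \<delta>)) f = 0"
    by (simp add: f_def V_def case_prod_unfold mult_ac)
  then have "(f has_integral 0) (cbox (t0 - \<delta>, x0 - \<delta>) (t0 + \<delta>, x0 + \<delta>))"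
    using integrable_continuous[OF fc] by (simp add: has_integral_iff)
  moreover have "0 \<le> f z" if "z \<in> box (t0 - \<delta>, x0 - \<delta>) (t0 + \<delta>, x0 + \<delta>)" for z
  proof -
    have "fst z \<in> box (t0 - \<delta>) (t0 + \<delta>)" "snd z \<in> box (x0 - \<delta>) (x0 + \<delta>)"
      using that by (auto simp: cbox_prod box_prod)
    then show ?thesis
      unfolding f_def using V[of z] box_subset_cbox that
      by (intro mult_nonneg_nonneg less_imp_le[OF bump_pos] less_imp_le[OF V]) auto
  qed
  moreover have "(t0, x0) \<in> box (t0 - \<delta>, x0 - \<delta>) (t0 + \<delta>, x0 + \<delta>)"
    using \<open>\<delta> > 0\<close> by (auto simp: cbox_prod box_prod)
  ultimately have "f (t0, x0) = 0"
    using has_integral_0_cbox_imp_0[OF fc] box_subset_cbox by blast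
  moreover have "f (t0, x0) > 0"
    unfolding f_def using \<open>\<delta> > 0\<close> \<open>V (t0, x0) > 0\<close> by (simp add: bump_pos)
  ultimately show False by simp
qed

section \<open>Moving derivatives off the test function\<close>

definition bump2 :: "nat \<Rightarrow> real \<Rightarrow> real \<Rightarrow> real \<Rightarrow> real \<Rightarrow> nat \<Rightarrow> nat \<Rightarrow> real \<Rightarrow> real \<Rightarrow> real" where
  "bump2 N a b c d i j t x = poly ((pderiv ^^ i) (bump N a b)) t * poly ((pderiv ^^ j) (bump N c d)) x"

lemma bump2_derivative:
  "((\<lambda>s. bump2 N a b c d i j s x) has_real_derivative bump2 N a b c d (Suc i) j t x) (at t)"
  "((\<lambda>s. bump2 N a b c d i j t s) has_real_derivative bump2 N a b c d i (Suc j) t x) (at x)"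
  unfolding bump2_def by (auto intro!: derivative_eq_intros)

lemma bump2_boundary:
  "i < N \<Longrightarrow> bump2 N a b c d i j a x = 0" "i < N \<Longrightarrow> bump2 N a b c d i j b x = 0"
  "j < N \<Longrightarrow> bump2 N a b c d i j t c = 0" "j < N \<Longrightarrow> bump2 N a b c d i j t d = 0"
  by (auto simp: bump2_def bump_endpoints)

lemma continuous_on_bump2 [continuous_intros]:
  "continuous_on A f \<Longrightarrow> continuous_on A g \<Longrightarrow> continuous_on A (\<lambda>z. bump2 N a b c d i j (f z) (g z))"
  unfolding bump2_def by (auto intro!: continuous_intros)

text \<open>The two integrands differ by a divergence whose components contain derivatives of
  \<open>\<phi>\<close> of order at most two in each variable; these vanish on the relevant sides
  because \<open>N \<ge> 3\<close>.\<close>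

lemma integration_by_parts:
  fixes a b c d :: real and N :: nat and Z K Kt Kx Kxx Kxxt K1 K1x K2 K2x K2xx K3 K3x K3xx K3xxx :: "real \<Rightarrow> real \<Rightarrow> real"
  defines "\<phi> \<equiv> bump2 N a b c d"
  assumes "a \<le> b" "c \<le> d" "N \<ge> 3"
  assumes t: "\<And>t x. ((\<lambda>s. K s x) has_real_derivative Kt t x) (at t)"
      "\<And>t x. ((\<lambda>s. Kxx s x) has_real_derivative Kxxt t x) (at t)"
    and x: "\<And>t x. ((\<lambda>s. K t s) has_real_derivative Kx t x) (at x)"
      "\<And>t x. ((\<lambda>s. Kx t s) has_real_derivative Kxx t x) (at x)"
      "\<And>t x. ((\<lambda>s. K1 t s) has_real_derivative K1x t x) (at x)"
      "\<And>t x. ((\<lambda>s. K2 t s) has_real_derivative K2x t x) (at x)"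
      "\<And>t x. ((\<lambda>s. K2x t s) has_real_derivative K2xx t x) (at x)"
      "\<And>t x. ((\<lambda>s. K3 t s) has_real_derivative K3x t x) (at x)"
      "\<And>t x. ((\<lambda>s. K3x t s) has_real_derivative K3xx t x) (at x)"
      "\<And>t x. ((\<lambda>s. K3xx t s) has_real_derivative K3xxx t x) (at x)"
    and cont: "\<And>F. F \<in> {Z, K, Kt, Kx, Kxx, Kxxt, K1, K1x, K2, K2x, K2xx, K3, K3x, K3xx, K3xxx}
        \<Longrightarrow> continuous_on UNIV (\<lambda>z. F (fst z) (snd z))"
  shows "integral (cbox (a, c) (b, d)) (\<lambda>(t, x). \<phi> 0 0 t x * Z t x + \<phi> 1 0 t x * K t x
       - \<phi> 1 2 t x * K t x + \<phi> 0 1 t x * K1 t x + \<phi> 0 2 t x * K2 t x + \<phi> 0 3 t x * K3 t x)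
     = integral (cbox (a, c) (b, d)) (\<lambda>(t, x). \<phi> 0 0 t x *
         (Z t x - Kt t x + Kxxt t x - K1x t x + K2xx t x - K3xxx t x))" (is "integral _ ?l = integral _ ?r")
proof -
  note num = numeral_2_eq_2 numeral_3_eq_3 One_nat_def
  have dt: "((\<lambda>s. \<phi> i j s x) has_real_derivative \<phi> (Suc i) j t x) (at t)" for i j t x
    unfolding \<phi>_def by (rule bump2_derivative)
  have dx: "((\<lambda>s. \<phi> i j t s) has_real_derivative \<phi> i (Suc j) t x) (at x)" for i j t x
    unfolding \<phi>_def by (rule bump2_derivative)
  note c = cont[of Z] cont[of K] cont[of Kt] cont[of Kx] cont[of Kxx] cont[of Kxxt] cont[of K1]
    cont[of K1x] cont[of K2] cont[of K2x] cont[of K2xx] cont[of K3] cont[of K3x] cont[of K3xx]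
    cont[of K3xxx]
  note c = c[simplified, THEN continuous_on_subset, OF subset_UNIV]
  have \<phi>c: "continuous_on A (\<lambda>z. \<phi> i j (fst z) (snd z))" for A i j
    unfolding \<phi>_def by (intro continuous_intros)
  have bd: "\<phi> i j a x = 0" "\<phi> i j b x = 0" "\<phi> j i t c = 0" "\<phi> j i t d = 0" if "i < 3" for i j t x
    unfolding \<phi>_def using that \<open>N \<ge> 3\<close> by (simp_all add: bump2_boundary)
  \<comment> \<open>The mixed term \<open>\<phi> 1 2 t x * K t x\<close> is treated by two
    integrations in \<open>x\<close> followed by one in \<open>t\<close>; the intermediate
    \<open>\<phi> 1 0 t x * Kxx t x\<close> occurs in \<open>A'\<close> and \<open>B'\<close> with
    opposite signs.\<close>
  define A' where "A' t x = \<phi> 1 0 t x * K t x + \<phi> 0 0 t x * Kt t x - \<phi> 1 0 t x * Kxx t x - \<phi> 0 0 t x * Kxxt t x" for t x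
  define B' where "B' t x = - \<phi> 1 2 t x * K t x + \<phi> 1 0 t x * Kxx t x + \<phi> 0 1 t x * K1 t x + \<phi> 0 0 t x * K1x t x
    + \<phi> 0 2 t x * K2 t x - \<phi> 0 0 t x * K2xx t x + \<phi> 0 3 t x * K3 t x + \<phi> 0 0 t x * K3xxx t x" for t x
  have div: "integral (cbox (a, c) (b, d)) (\<lambda>(t, x). A' t x + B' t x) = 0"
  proof (rule integral_divergence_eq_0)
    show "((\<lambda>s. \<phi> 0 0 s x * K s x - \<phi> 0 0 s x * Kxx s x) has_real_derivative A' t x) (at t)" for t x
      unfolding A'_def
      by (rule DERIV_cong, (rule DERIV_diff DERIV_mult dt t)+) (simp add: num algebra_simps)
    show "((\<lambda>s. - \<phi> 1 1 t s * K t s + \<phi> 1 0 t s * Kx t s + \<phi> 0 0 t s * K1 t s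
         + \<phi> 0 1 t s * K2 t s - \<phi> 0 0 t s * K2x t s
         + \<phi> 0 2 t s * K3 t s - \<phi> 0 1 t s * K3x t s + \<phi> 0 0 t s * K3xx t s) has_real_derivative B' t x) (at x)" for t x
      unfolding B'_def
      by (rule DERIV_cong, (rule DERIV_add DERIV_diff DERIV_mult DERIV_minus dx x)+)
        (simp only: num, simp add: algebra_simps)
    show "continuous_on (cbox (a, c) (b, d)) (\<lambda>(t, x). A' t x)"
      "continuous_on (cbox (a, c) (b, d)) (\<lambda>(t, x). B' t x)"
      unfolding A'_def B'_def case_prod_unfold by (intro continuous_intros c \<phi>c)+
  qed (use \<open>a \<le> b\<close> \<open>c \<le> d\<close> in \<open>auto simp: bd bd[where i = 1, simplified]\<close>)
  have eq: "(\<lambda>(t, x). A' t x + B' t x) = (\<lambda>z. ?l z - ?r z)"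
    unfolding A'_def B'_def by (auto simp: fun_eq_iff algebra_simps)
  have int: "?l integrable_on cbox (a, c) (b, d)" "?r integrable_on cbox (a, c) (b, d)"
    unfolding case_prod_unfold
    by (intro integrable_continuous continuous_intros c \<phi>c)+
  show ?thesis
    using div unfolding eq integral_diff[OF int] right_minus_eq .
qed

section \<open>Functions of \<open>t\<close>, \<open>x\<close> and \<open>u\<close>\<close>

text \<open>The values at the derivatives of \<open>u\<close> are junk.\<close>

definition base_jet :: "real \<Rightarrow> real \<Rightarrow> real \<Rightarrow> jet" where
  "base_jet t x u = (\<lambda>v. case v of Tvar \<Rightarrow> t | Xvar \<Rightarrow> x | Uvar i j \<Rightarrow> u)"

definition order0 :: "(jet \<Rightarrow> real) \<Rightarrow> bool" where
  "order0 F \<longleftrightarrow> jsmooth F \<and> depends_only_on F (jvars_upto 0)"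

lemma order0_jpartial: "order0 F \<Longrightarrow> order0 (jpartial v F)"
  by (simp add: order0_def jsmoothD(3) depends_only_on_jpartial)

lemma jvars_upto_0: "jvars_upto 0 = {Tvar, Xvar, Uvar 0 0}"
  by (auto simp: jvars_upto_def)

lemma order0_base_jet:
  assumes "order0 F"
  shows "F p = F (base_jet (p Tvar) (p Xvar) (p (Uvar 0 0)))"
  using assms unfolding order0_def
  by (intro depends_only_onD[of F "jvars_upto 0"]) (auto simp: jvars_upto_0 base_jet_def)

lemma pairs_sum_le_0: "{(i, j). i + j \<le> (0::nat)} = {(0, 0)}"
  by auto

lemma order0_t_derivative:
  assumes "order0 F"
  shows "((\<lambda>s. F (jet_of (sepsum L) s x)) has_real_derivative
     jpartial Tvar F (jet_of (sepsum L) t x)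
     + jet_of (sepsum L) t x (Uvar 1 0) * jpartial (Uvar 0 0) F (jet_of (sepsum L) t x)) (at t)"
  using total_t_jet[of 0 F L x t] total_t_eq[of F 0] assms
  unfolding order0_def differential_function_of_order_def pairs_sum_le_0 by simp

lemma order0_x_derivative:
  assumes "order0 F"
  shows "((\<lambda>s. F (jet_of (sepsum L) t s)) has_real_derivative
     jpartial Xvar F (jet_of (sepsum L) t x)
     + jet_of (sepsum L) t x (Uvar 0 1) * jpartial (Uvar 0 0) F (jet_of (sepsum L) t x)) (at x)"
  using total_x_jet[of 0 F L t x] total_x_eq[of F 0] assms
  unfolding order0_def differential_function_of_order_def pairs_sum_le_0 by simp

section \<open>The Euler-Lagrange condition\<close>

text \<open>Together with the coordinates of \<open>E\<close>, the set contains \<open>t\<close> and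
  \<open>x\<close>, so that a product of \<open>E\<close> with a function of \<open>t\<close>,
  \<open>x\<close>, \<open>u\<close> depends on it alone.\<close>

definition E_vars :: "jvar set" where
  "E_vars = {Tvar, Xvar, Uvar 0 0, Uvar 1 0, Uvar 0 1, Uvar 0 2, Uvar 0 3, Uvar 1 2}"

lemma jsmooth_E_eq: "jsmooth (E_eq n)"
proof -
  have "jsmooth (\<lambda>p. p (Uvar 1 0) - p (Uvar 1 2)
        + (real n + 1) * (real n + 2) / 2 * p (Uvar 0 0) ^ n * p (Uvar 0 1)
        - real n * (real n - 1) / 2 * p (Uvar 0 0) ^ (n - 2) * p (Uvar 0 1) ^ 3
        - 2 * real n * p (Uvar 0 0) ^ (n - 1) * p (Uvar 0 1) * p (Uvar 0 2)
        - p (Uvar 0 0) ^ n * p (Uvar 0 3))"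
    by (intro jsmooth_intros)
  moreover have "E_eq n = (\<lambda>p. p (Uvar 1 0) - p (Uvar 1 2)
        + (real n + 1) * (real n + 2) / 2 * p (Uvar 0 0) ^ n * p (Uvar 0 1)
        - real n * (real n - 1) / 2 * p (Uvar 0 0) ^ (n - 2) * p (Uvar 0 1) ^ 3
        - 2 * real n * p (Uvar 0 0) ^ (n - 1) * p (Uvar 0 1) * p (Uvar 0 2)
        - p (Uvar 0 0) ^ n * p (Uvar 0 3))"
    by (simp add: fun_eq_iff E_eq_def Let_def)
  ultimately show ?thesis by simp
qed

lemma depends_only_on_E_eq: "depends_only_on (E_eq n) E_vars"
  unfolding depends_only_on_def by (simp add: E_eq_def E_vars_def Let_def)

text \<open>Wherever a truncated exponent such as \<open>n - 2 - 1\<close> differs from the true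
  one, the coefficient in front of it is zero.\<close>

lemma jpartial_E_eq:
  "jpartial (Uvar 1 0) (E_eq n) p = 1"
  "jpartial (Uvar 1 2) (E_eq n) p = - 1"
  "jpartial (Uvar 0 1) (E_eq n) p = (real n + 1) * (real n + 2) / 2 * p (Uvar 0 0) ^ n
     - 3 * (real n * (real n - 1) / 2) * p (Uvar 0 0) ^ (n - 2) * p (Uvar 0 1) ^ 2
     - 2 * real n * p (Uvar 0 0) ^ (n - 1) * p (Uvar 0 2)"
  "jpartial (Uvar 0 2) (E_eq n) p = - 2 * real n * p (Uvar 0 0) ^ (n - 1) * p (Uvar 0 1)"
  "jpartial (Uvar 0 3) (E_eq n) p = - (p (Uvar 0 0) ^ n)"
  "jpartial (Uvar 0 0) (E_eq n) p =
     (real n + 1) * (real n + 2) / 2 * (real n * p (Uvar 0 0) ^ (n - 1)) * p (Uvar 0 1)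
     - real n * (real n - 1) / 2 * (real (n - 2) * p (Uvar 0 0) ^ (n - 2 - 1)) * p (Uvar 0 1) ^ 3
     - 2 * real n * (real (n - 1) * p (Uvar 0 0) ^ (n - 1 - 1)) * p (Uvar 0 1) * p (Uvar 0 2)
     - real n * p (Uvar 0 0) ^ (n - 1) * p (Uvar 0 3)"
proof -
  show "jpartial (Uvar 1 0) (E_eq n) p = 1"
    by (rule jpartialI) (auto simp: E_eq_def Let_def intro!: derivative_eq_intros)
  show "jpartial (Uvar 1 2) (E_eq n) p = - 1"
    by (rule jpartialI) (auto simp: E_eq_def Let_def intro!: derivative_eq_intros)
  show "jpartial (Uvar 0 2) (E_eq n) p = - 2 * real n * p (Uvar 0 0) ^ (n - 1) * p (Uvar 0 1)"
    by (rule jpartialI) (auto simp: E_eq_def Let_def intro!: derivative_eq_intros)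
  show   "jpartial (Uvar 0 3) (E_eq n) p = - (p (Uvar 0 0) ^ n)"
    by (rule jpartialI) (auto simp: E_eq_def Let_def intro!: derivative_eq_intros)
  have "((\<lambda>s. a - b + c1 * u ^ n * s - c2 * u ^ (n - 2) * s ^ 3 - c3 * u ^ (n - 1) * s * v - u ^ n * w)
    has_real_derivative c1 * u ^ n - 3 * c2 * u ^ (n - 2) * s ^ 2 - c3 * u ^ (n - 1) * v) (at s)"
    for a b c1 c2 c3 u v w s :: real
    by (rule DERIV_cong, (rule DERIV_add DERIV_diff DERIV_ident DERIV_const DERIV_power DERIV_mult)+) simp
  from this[of "p (Uvar 1 0)" "p (Uvar 1 2)" "(real n + 1) * (real n + 2) / 2" "p (Uvar 0 0)"
      "real n * (real n - 1) / 2" "2 * real n" "p (Uvar 0 2)" "p (Uvar 0 3)" "p (Uvar 0 1)"]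
  show "jpartial (Uvar 0 1) (E_eq n) p = (real n + 1) * (real n + 2) / 2 * p (Uvar 0 0) ^ n
     - 3 * (real n * (real n - 1) / 2) * p (Uvar 0 0) ^ (n - 2) * p (Uvar 0 1) ^ 2
     - 2 * real n * p (Uvar 0 0) ^ (n - 1) * p (Uvar 0 2)"
    by (intro jpartialI) (simp add: E_eq_def Let_def)
  have "((\<lambda>u. a - b + c1 * u ^ n * s - c2 * u ^ (n - 2) * s ^ 3 - c3 * u ^ (n - 1) * s * v - u ^ n * w)
    has_real_derivative c1 * (real n * u ^ (n - 1)) * s - c2 * (real (n - 2) * u ^ (n - 2 - 1)) * s ^ 3
      - c3 * (real (n - 1) * u ^ (n - 1 - 1)) * s * v - real n * u ^ (n - 1) * w) (at u)"
    for a b c1 c2 c3 u v w s :: real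
    by (rule DERIV_cong, (rule DERIV_add DERIV_diff DERIV_ident DERIV_const DERIV_power DERIV_mult)+) simp
  from this[of "p (Uvar 1 0)" "p (Uvar 1 2)" "(real n + 1) * (real n + 2) / 2" "p (Uvar 0 1)"
      "real n * (real n - 1) / 2" "2 * real n" "p (Uvar 0 2)" "p (Uvar 0 3)" "p (Uvar 0 0)"]
  show "jpartial (Uvar 0 0) (E_eq n) p =
     (real n + 1) * (real n + 2) / 2 * (real n * p (Uvar 0 0) ^ (n - 1)) * p (Uvar 0 1)
     - real n * (real n - 1) / 2 * (real (n - 2) * p (Uvar 0 0) ^ (n - 2 - 1)) * p (Uvar 0 1) ^ 3
     - 2 * real n * (real (n - 1) * p (Uvar 0 0) ^ (n - 1 - 1)) * p (Uvar 0 1) * p (Uvar 0 2)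
     - real n * p (Uvar 0 0) ^ (n - 1) * p (Uvar 0 3)"
    by (intro jpartialI) (simp add: E_eq_def Let_def)
qed

text \<open>The Euler-Lagrange expression of \<open>F E\<close> at \<open>(t0, x0)\<close> along the polynomial with
  \<open>u = k\<close>, \<open>u\<^sub>t = q\<close>, \<open>u\<^sub>x = 0\<close>, \<open>u\<^sub>x\<^sub>x = r\<close>, \<open>u\<^sub>t\<^sub>x = s\<close> and \<open>u\<^sub>t\<^sub>t = 0\<close> there.\<close>

lemma euler_condition:
  fixes k q r s t0 x0 :: real
  assumes F: "order0 F"
    and C: "differential_function_of_order m C0" "differential_function_of_order m C1"
    and div: "\<And>L t x. total_t C0 (jet_of (sepsum L) t x) + total_x C1 (jet_of (sepsum L) t x)
                  = F (jet_of (sepsum L) t x) * E_eq n (jet_of (sepsum L) t x)"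
  defines "T \<equiv> jpartial Tvar" and "X \<equiv> jpartial Xvar" and "U \<equiv> jpartial (Uvar 0 0)"
    and "p \<equiv> base_jet t0 x0 k"
  shows "T (X (X F)) p + q * U (X (X F)) p + s * (U (X F) p + X (U F) p)
     + r * (T (U F) p + q * U (U F) p) - T F p + r * real n * k ^ (n - 1) * X F p
     + r * k ^ n * (U (X F) p + 2 * X (U F) p)
     - (real n + 1) * (real n + 2) / 2 * k ^ n * X F p + k ^ n * X (X (X F)) p = 0"
proof -
  \<comment> \<open>The summands are \<open>k + q * (t - t0)\<close>,
    \<open>r / 2 * (x - x0)^2\<close> and \<open>s * (t - t0) * (x - x0)\<close>. They prescribe the
    2-jet at the point, and the derivatives \<open>u_xxx\<close> and \<open>u_txx\<close> vanish
    identically.\<close>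
  define L where "L = [([:k - q * t0, q:], 1 :: real poly), ([:r / 2:], [:- x0, 1:] ^ 2),
    ([:- s * t0, s:], [:- x0, 1:])]"
  define J where "J = jet_of (sepsum L)"
  define u where "u t x = k + q * (t - t0) + r / 2 * (x - x0)\<^sup>2 + s * (t - t0) * (x - x0)" for t x
  define ux where "ux t x = r * (x - x0) + s * (t - t0)" for t x
  define ut where "ut x = q + s * (x - x0)" for x
  note num = numeral_2_eq_2 numeral_3_eq_3 One_nat_def
  have J: "J t x (Uvar 0 0) = u t x" "J t x (Uvar 0 1) = ux t x" "J t x (Uvar 1 0) = ut x"
    "J t x (Uvar 0 2) = r" "J t x (Uvar 0 3) = 0" "J t x (Uvar 1 2) = 0" for t x
    unfolding J_def jet_of_sepsum L_def u_def ux_def ut_def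
    by (simp_all add: num pderiv_pCons pderiv_mult algebra_simps)
  have JT: "J t x Tvar = t" "J t x Xvar = x" for t x by (simp_all add: J_def)
  have dx: "((\<lambda>s. G (J t s)) has_real_derivative X G (J t x) + ux t x * U G (J t x)) (at x)"
    if "order0 G" for G t x
    using order0_x_derivative[OF that, of L t x] unfolding J_def[symmetric] J X_def U_def .
  have dt: "((\<lambda>s. G (J s x)) has_real_derivative T G (J t x) + ut x * U G (J t x)) (at t)"
    if "order0 G" for G t x
    using order0_t_derivative[OF that, of L x t] unfolding J_def[symmetric] J T_def U_def .
  have u_dx: "((\<lambda>s. u t s) has_real_derivative ux t x) (at x)" for t x
    unfolding u_def ux_def by (auto intro!: derivative_eq_intros)
  have ux_dx: "((\<lambda>s. ux t s) has_real_derivative r) (at x)" for t x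
    unfolding ux_def by (auto intro!: derivative_eq_intros)
  have ux_dt: "((\<lambda>t. ux t x) has_real_derivative s) (at t)" for t x
    unfolding ux_def by (auto intro!: derivative_eq_intros)
  have ord: "order0 (T G)" "order0 (X G)" "order0 (U G)" if "order0 G" for G
    using that by (simp_all add: T_def X_def U_def order0_jpartial)
  note ord1 = ord[OF F]
  note ord2 = ord1[THEN ord(1)] ord1[THEN ord(2)] ord1[THEN ord(3)]
  note ord3 = ord2[THEN ord(1)] ord2[THEN ord(2)] ord2[THEN ord(3)]
  note ords = F ord1 ord2 ord3
  note dK = DERIV_add DERIV_mult DERIV_const ords[THEN dx] ords[THEN dt] u_dx ux_dx ux_dt
  note dw = DERIV_add DERIV_diff DERIV_mult DERIV_power DERIV_const u_dx ux_dx
  \<comment> \<open>\<open>K\<close> is \<open>F\<close> along \<open>u\<close>, and the suffixes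
    record its derivatives expanded by the chain rule. They are needed as functions, not only at
    \<open>(t0, x0)\<close>, because they are integrated over rectangles.\<close>
  define K where "K t x = F (J t x)" for t x
  define Kx where "Kx t x = X F (J t x) + ux t x * U F (J t x)" for t x
  define Kxx where "Kxx t x = X (X F) (J t x) + ux t x * U (X F) (J t x)
     + (r * U F (J t x) + ux t x * (X (U F) (J t x) + ux t x * U (U F) (J t x)))" for t x
  define Kxxx where "Kxxx t x = X (X (X F)) (J t x) + ux t x * U (X (X F)) (J t x)
     + (r * U (X F) (J t x) + ux t x * (X (U (X F)) (J t x) + ux t x * U (U (X F)) (J t x)))
     + (r * (X (U F) (J t x) + ux t x * U (U F) (J t x))
        + (r * (X (U F) (J t x) + ux t x * U (U F) (J t x))
           + ux t x * (X (X (U F)) (J t x) + ux t x * U (X (U F)) (J t x)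
             + (r * U (U F) (J t x) + ux t x * (X (U (U F)) (J t x) + ux t x * U (U (U F)) (J t x))))))" for t x
  define Kt where "Kt t x = T F (J t x) + ut x * U F (J t x)" for t x
  define Kxxt where "Kxxt t x = T (X (X F)) (J t x) + ut x * U (X (X F)) (J t x)
     + (s * U (X F) (J t x) + ux t x * (T (U (X F)) (J t x) + ut x * U (U (X F)) (J t x)))
     + (r * (T (U F) (J t x) + ut x * U (U F) (J t x))
        + (s * (X (U F) (J t x) + ux t x * U (U F) (J t x))
           + ux t x * (T (X (U F)) (J t x) + ut x * U (X (U F)) (J t x)
             + (s * U (U F) (J t x) + ux t x * (T (U (U F)) (J t x) + ut x * U (U (U F)) (J t x))))))" for t x
  have K_dx: "((\<lambda>s. K t s) has_real_derivative Kx t x) (at x)"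
    "((\<lambda>s. Kx t s) has_real_derivative Kxx t x) (at x)"
    "((\<lambda>s. Kxx t s) has_real_derivative Kxxx t x) (at x)" for t x
    unfolding K_def Kx_def Kxx_def Kxxx_def
    by (rule DERIV_cong, (rule dK)+, simp add: algebra_simps)+
  have K_dt: "((\<lambda>s. K s x) has_real_derivative Kt t x) (at t)"
    "((\<lambda>s. Kxx s x) has_real_derivative Kxxt t x) (at t)" for t x
    unfolding K_def Kt_def Kxx_def Kxxt_def
    by (rule DERIV_cong, (rule dK)+, simp add: algebra_simps)+
  \<comment> \<open>With \<open>w\<close> for the \<open>n\<close>-th power of \<open>u\<close>, the
    derivatives of \<open>E\<close> in \<open>u_xxx\<close> and \<open>u_xx\<close> along
    \<open>u\<close> are \<open>- w\<close> and \<open>- 2 * wx\<close>.\<close>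
  define w where "w t x = u t x ^ n" for t x
  define wx where "wx t x = real n * u t x ^ (n - 1) * ux t x" for t x
  define wxx where "wxx t x = real n * (real (n - 1) * u t x ^ (n - 1 - 1) * (ux t x)\<^sup>2 + u t x ^ (n - 1) * r)" for t x
  define wxxx where "wxxx t x = real n * (real (n - 1) * (real (n - 1 - 1) * u t x ^ (n - 1 - 1 - 1) * ux t x ^ 3
     + 2 * u t x ^ (n - 1 - 1) * ux t x * r) + real (n - 1) * u t x ^ (n - 1 - 1) * ux t x * r)" for t x
  have w_dx: "((\<lambda>s. w t s) has_real_derivative wx t x) (at x)"
    "((\<lambda>s. wx t s) has_real_derivative wxx t x) (at x)"
    "((\<lambda>s. wxx t s) has_real_derivative wxxx t x) (at x)" for t x
    unfolding w_def wx_def wxx_def wxxx_def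
    by (rule DERIV_cong, (rule dw)+, simp add: algebra_simps power2_eq_square power3_eq_cube)+
  \<comment> \<open>The derivative of \<open>E\<close> in the coordinate \<open>u_x\<close>, taken
    along \<open>u\<close>.\<close>
  define g where "g t x = (real n + 1) * (real n + 2) / 2 * u t x ^ n
     - 3 * (real n * (real n - 1) / 2) * u t x ^ (n - 2) * (ux t x)\<^sup>2 - 2 * real n * u t x ^ (n - 1) * r" for t x
  define gx where "gx t x = (real n + 1) * (real n + 2) / 2 * (real n * u t x ^ (n - 1) * ux t x)
     - 3 * (real n * (real n - 1) / 2) * (real (n - 2) * u t x ^ (n - 2 - 1) * ux t x ^ 3 + 2 * u t x ^ (n - 2) * ux t x * r)
     - 2 * real n * (real (n - 1) * u t x ^ (n - 1 - 1) * ux t x) * r" for t x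
  have g_dx: "((\<lambda>s. g t s) has_real_derivative gx t x) (at x)" for t x
    unfolding g_def gx_def
    by (rule DERIV_cong, (rule dw)+, simp add: algebra_simps power2_eq_square power3_eq_cube)+
  \<comment> \<open>\<open>Z\<close>, \<open>K1 = K g\<close>, \<open>K2\<close> and \<open>K3\<close> are the coefficients of \<open>\<phi>\<close>, \<open>\<phi>\<^sub>x\<close>, \<open>\<phi>\<^sub>x\<^sub>x\<close> and \<open>\<phi>\<^sub>x\<^sub>x\<^sub>x\<close> in
    the linearization of \<open>F E\<close>; those of \<open>\<phi>\<^sub>t\<close> and \<open>\<phi>\<^sub>t\<^sub>x\<^sub>x\<close> are \<open>K\<close> and \<open>- K\<close>.\<close>
  define Z where "Z t x = U F (J t x) * E_eq n (J t x) + F (J t x) * jpartial (Uvar 0 0) (E_eq n) (J t x)" for t x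
  note DX = DERIV_add DERIV_minus DERIV_mult DERIV_const K_dx w_dx g_dx
  define K1x where "K1x t x = Kx t x * g t x + K t x * gx t x" for t x
  define K2 where "K2 t x = - 2 * (K t x * wx t x)" for t x
  define K2x where "K2x t x = - 2 * (Kx t x * wx t x + K t x * wxx t x)" for t x
  define K2xx where "K2xx t x = - 2 * (Kxx t x * wx t x + 2 * Kx t x * wxx t x + K t x * wxxx t x)" for t x
  define K3 where "K3 t x = - (K t x * w t x)" for t x
  define K3x where "K3x t x = - (Kx t x * w t x + K t x * wx t x)" for t x
  define K3xx where "K3xx t x = - (Kxx t x * w t x + 2 * Kx t x * wx t x + K t x * wxx t x)" for t x
  define K3xxx where "K3xxx t x = - (Kxxx t x * w t x + 3 * Kxx t x * wx t x + 3 * Kx t x * wxx t x + K t x * wxxx t x)" for t x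
  \<comment> \<open>A coefficient of a derivative of \<open>\<phi>\<close> of total order
    \<open>l\<close> enters with the sign \<open>(-1)^l\<close>; for \<open>Kxxt\<close> this sign
    cancels against the coefficient \<open>- K\<close>.\<close>
  define W where "W t x = Z t x - Kt t x + Kxxt t x - K1x t x + K2xx t x - K3xxx t x" for t x
  have cJ: "continuous_on UNIV (\<lambda>z. G (J (fst z) (snd z)))" if "order0 G" for G
    using continuous_on_jsmooth_jet[of G UNIV L] that by (simp add: order0_def J_def case_prod_unfold)
  have cJ': "continuous_on UNIV (\<lambda>z. G (J (fst z) (snd z)))" if "jsmooth G" for G
    using continuous_on_jsmooth_jet[of G UNIV L] that by (simp add: J_def case_prod_unfold)
  have cu: "continuous_on UNIV (\<lambda>z. u (fst z) (snd z))" "continuous_on UNIV (\<lambda>z. ux (fst z) (snd z))"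
    "continuous_on UNIV (\<lambda>z::real\<times>real. ut (snd z))"
    unfolding u_def ux_def ut_def by (intro continuous_intros)+
  have cK: "continuous_on UNIV (\<lambda>z. K (fst z) (snd z))" "continuous_on UNIV (\<lambda>z. Kx (fst z) (snd z))"
    "continuous_on UNIV (\<lambda>z. Kxx (fst z) (snd z))" "continuous_on UNIV (\<lambda>z. Kxxx (fst z) (snd z))"
    "continuous_on UNIV (\<lambda>z. Kt (fst z) (snd z))" "continuous_on UNIV (\<lambda>z. Kxxt (fst z) (snd z))"
    unfolding K_def Kx_def Kxx_def Kxxx_def Kt_def Kxxt_def
    by (intro continuous_intros ords[THEN cJ] cu)+
  have cw: "continuous_on UNIV (\<lambda>z. w (fst z) (snd z))" "continuous_on UNIV (\<lambda>z. wx (fst z) (snd z))"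
    "continuous_on UNIV (\<lambda>z. wxx (fst z) (snd z))" "continuous_on UNIV (\<lambda>z. wxxx (fst z) (snd z))"
    "continuous_on UNIV (\<lambda>z. g (fst z) (snd z))" "continuous_on UNIV (\<lambda>z. gx (fst z) (snd z))"
    unfolding w_def wx_def wxx_def wxxx_def g_def gx_def
    by (intro continuous_intros cu)+
  have cZ: "continuous_on UNIV (\<lambda>z. Z (fst z) (snd z))"
    unfolding Z_def by (intro continuous_intros ords[THEN cJ] cJ'[OF jsmooth_E_eq] cJ'[OF jsmoothD(3)[OF jsmooth_E_eq]])
  have c3: "continuous_on UNIV (\<lambda>z. K (fst z) (snd z) * g (fst z) (snd z))"
    "continuous_on UNIV (\<lambda>z. K1x (fst z) (snd z))"
    "continuous_on UNIV (\<lambda>z. K2 (fst z) (snd z))" "continuous_on UNIV (\<lambda>z. K2x (fst z) (snd z))"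
    "continuous_on UNIV (\<lambda>z. K2xx (fst z) (snd z))" "continuous_on UNIV (\<lambda>z. K3 (fst z) (snd z))"
    "continuous_on UNIV (\<lambda>z. K3x (fst z) (snd z))" "continuous_on UNIV (\<lambda>z. K3xx (fst z) (snd z))"
    "continuous_on UNIV (\<lambda>z. K3xxx (fst z) (snd z))"
    unfolding K1x_def K2_def K2x_def K2xx_def K3_def K3x_def K3xx_def K3xxx_def
    by (intro continuous_intros cK cw)+
  define H where "H p = F p * E_eq n p" for p
  have H_smooth: "jsmooth H"
    unfolding H_def using F by (intro jsmooth_mult jsmooth_E_eq) (simp add: order0_def)
  have H_dep: "depends_only_on H E_vars"
  proof -
    have "depends_only_on F E_vars"
      using F unfolding order0_def jvars_upto_0
      by (auto simp: E_vars_def intro: depends_only_on_mono)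
    with depends_only_on_E_eq[of n] show ?thesis
      unfolding depends_only_on_def H_def by metis
  qed
  have jH: "jpartial v H p = jpartial v F p * E_eq n p + F p * jpartial v (E_eq n) p" for v p
    unfolding H_def using F jsmooth_E_eq[of n] by (intro jpartial_mult) (auto simp: jalgebra_iff order0_def)
  have F0: "jpartial (Uvar i j) F p = 0" if "i + j > 0" for i j p
    using F that unfolding order0_def by (intro jpartial_eq_0[of F "jvars_upto 0"]) (auto simp: jvars_upto_0)
  \<comment> \<open>Large enough both for the first variation (\<open>m < N\<close>) and for the
    integration by parts (\<open>N \<ge> 3\<close>).\<close>
  define N where "N = m + 3"
  have "W t0 x0 = 0"
  proof (rule fundamental_lemma_of_variations[where W = W and N = N])
    show "continuous_on UNIV (\<lambda>(t, x). W t x)"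
      unfolding W_def case_prod_unfold by (intro continuous_intros cK cw cZ c3)
    fix a b c d assume ab: "a < t0" "t0 < b" "c < x0" "x0 < d"
    have "0 = integral (cbox (a, c) (b, d)) (\<lambda>(t, x). \<Sum>v\<in>E_vars. (case v of Tvar \<Rightarrow> 0 | Xvar \<Rightarrow> 0
      | Uvar i j \<Rightarrow> poly ((pderiv ^^ i) (bump N a b)) t * poly ((pderiv ^^ j) (bump N c d)) x)
      * jpartial v H (jet_of (sepsum L) t x))"
      using ab by (intro first_variation[OF C _ _ _ H_smooth H_dep, symmetric])
        (auto simp: div H_def N_def E_vars_def)
    also have "\<dots> = integral (cbox (a, c) (b, d)) (\<lambda>(t, x). bump2 N a b c d 0 0 t x * Z t x
       + bump2 N a b c d 1 0 t x * K t x - bump2 N a b c d 1 2 t x * K t x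
       + bump2 N a b c d 0 1 t x * (K t x * g t x) + bump2 N a b c d 0 2 t x * K2 t x
       + bump2 N a b c d 0 3 t x * K3 t x)"
      by (intro arg_cong[where f = "integral _"] ext)
        (simp add: E_vars_def jH F0 jpartial_E_eq(1-5)[unfolded One_nat_def] bump2_def Z_def K_def K2_def K3_def
          J[unfolded One_nat_def] w_def wx_def g_def U_def J_def[symmetric] case_prod_unfold
          algebra_simps power2_eq_square)
    also have "\<dots> = integral (cbox (a, c) (b, d)) (\<lambda>(t, x). bump2 N a b c d 0 0 t x *
         (Z t x - Kt t x + Kxxt t x - K1x t x + K2xx t x - K3xxx t x))"
    proof (rule integration_by_parts[where Kx = Kx and Kxx = Kxx and K2x = K2x and K3x = K3x and K3xx = K3xx])
      show "((\<lambda>s. K t s * g t s) has_real_derivative K1x t x) (at x)"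
        "((\<lambda>s. K2 t s) has_real_derivative K2x t x) (at x)"
        "((\<lambda>s. K2x t s) has_real_derivative K2xx t x) (at x)"
        "((\<lambda>s. K3 t s) has_real_derivative K3x t x) (at x)"
        "((\<lambda>s. K3x t s) has_real_derivative K3xx t x) (at x)"
        "((\<lambda>s. K3xx t s) has_real_derivative K3xxx t x) (at x)" for t x
        unfolding K1x_def K2_def K2x_def K2xx_def K3_def K3x_def K3xx_def K3xxx_def
        by (rule DERIV_cong, (rule DX)+, simp add: algebra_simps)+
    qed (use ab K_dx K_dt cK cZ c3 in \<open>auto simp: N_def\<close>)
    finally show "integral (cbox (a, c) (b, d))
        (\<lambda>(t, x). poly (bump N a b) t * poly (bump N c d) x * W t x) = 0"
      by (simp add: bump2_def W_def)
  qed
  moreover have Jp: "G (J t0 x0) = G p" if "order0 G" for G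
    using order0_base_jet[OF that, of "J t0 x0"] unfolding JT J by (simp add: p_def u_def)
  moreover have "u t0 x0 = k" "ux t0 x0 = 0" "ut x0 = q" by (simp_all add: u_def ux_def ut_def)
  \<comment> \<open>Every other term of \<open>E\<close>, and every term of its derivative in
    \<open>u\<close>, has a factor \<open>u_x\<close>, \<open>u_xxx\<close> or \<open>u_txx\<close>,
    all zero here. Thus \<open>Z\<close> reduces to \<open>q * U F p\<close>, which cancels the same
    term in \<open>Kt\<close>.\<close>
  moreover have "E_eq n (J t0 x0) = q" "jpartial (Uvar 0 0) (E_eq n) (J t0 x0) = 0"
    unfolding jpartial_E_eq using \<open>ux t0 x0 = 0\<close> \<open>ut x0 = q\<close>
    by (simp_all add: E_eq_def Let_def J[unfolded One_nat_def] J)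
  ultimately show ?thesis
    by (simp add: ords[THEN Jp] W_def Z_def Kt_def Kxxt_def K1x_def K2xx_def K3xxx_def K_def Kx_def Kxx_def Kxxx_def
        w_def wx_def wxx_def wxxx_def g_def gx_def algebra_simps)
qed

section \<open>Solving the determining equations\<close>

lemma order0_base_derivatives:
  assumes "order0 G"
  shows "((\<lambda>s. G (base_jet s x u)) has_real_derivative jpartial Tvar G (base_jet t x u)) (at t)"
    and "((\<lambda>s. G (base_jet t s u)) has_real_derivative jpartial Xvar G (base_jet t x u)) (at x)"
    and "((\<lambda>s. G (base_jet t x s)) has_real_derivative jpartial (Uvar 0 0) G (base_jet t x u)) (at u)"
proof -
  have G: "jsmooth G" using assms by (simp add: order0_def)
  have eq: "base_jet s x u = (base_jet t x u)(Tvar := s)" "base_jet t s u = (base_jet t x u)(Xvar := s)" for s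
    by (auto simp: base_jet_def fun_eq_iff split: jvar.splits)
  show "((\<lambda>s. G (base_jet s x u)) has_real_derivative jpartial Tvar G (base_jet t x u)) (at t)"
    using has_real_derivative_jpartial[OF G, of "base_jet t x u" Tvar t]
    unfolding eq(1)[symmetric] .
  show "((\<lambda>s. G (base_jet t s u)) has_real_derivative jpartial Xvar G (base_jet t x u)) (at x)"
    using has_real_derivative_jpartial[OF G, of "base_jet t x u" Xvar x]
    unfolding eq(2)[symmetric] .
  \<comment> \<open>Unlike for \<open>t\<close> and \<open>x\<close>, the updated jet may differ
    from \<open>base_jet t x s\<close> in the junk coordinates, so \<open>order0\<close> is used for
    the function and for its derivative.\<close>
  have eqU: "H ((base_jet t x u)(Uvar 0 0 := s)) = H (base_jet t x s)" if "order0 H" for H s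
    by (subst order0_base_jet[OF that]) (simp add: base_jet_def)
  show "((\<lambda>s. G (base_jet t x s)) has_real_derivative jpartial (Uvar 0 0) G (base_jet t x u)) (at u)"
    using has_real_derivative_jpartial[OF G, of "base_jet t x u" "Uvar 0 0" u]
    unfolding eqU[OF assms] eqU[OF order0_jpartial[OF assms]] .
qed

text \<open>Symmetry of mixed partial derivatives is not presupposed: \<open>X (U F) = U (X F)\<close> is read off
  once \<open>U (U F) = 0\<close> has made \<open>F\<close> affine in \<open>u\<close>.\<close>

lemma order0_affine:
  fixes n :: nat
  assumes "n \<ge> 1" and F: "order0 F"
    and euler: "\<And>t x k q r s. let p = base_jet t x k; T = jpartial Tvar; X = jpartial Xvar; U = jpartial (Uvar 0 0) in
      T (X (X F)) p + q * U (X (X F)) p + s * (U (X F) p + X (U F) p)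
     + r * (T (U F) p + q * U (U F) p) - T F p + r * real n * k ^ (n - 1) * X F p
     + r * k ^ n * (U (X F) p + 2 * X (U F) p)
     - (real n + 1) * (real n + 2) / 2 * k ^ n * X F p + k ^ n * X (X (X F)) p = 0"
  shows "\<exists>c1 c2. \<forall>t x u. F (base_jet t x u) = c1 + c2 * u"
proof -
  define T X U where "T = jpartial Tvar" and "X = jpartial Xvar" and "U = jpartial (Uvar 0 0)"
  let ?b = base_jet
  have ord: "order0 (T G)" "order0 (X G)" "order0 (U G)" if "order0 G" for G
    using that by (simp_all add: T_def X_def U_def order0_jpartial)
  have dT: "((\<lambda>s. G (?b s x u)) has_real_derivative T G (?b t x u)) (at t)"
    and dX: "((\<lambda>s. G (?b t s u)) has_real_derivative X G (?b t x u)) (at x)"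
    and dU: "((\<lambda>s. G (?b t x s)) has_real_derivative U G (?b t x u)) (at u)"
    if "order0 G" for G t x u
    using order0_base_derivatives[OF that] by (simp_all add: T_def X_def U_def)
  have e: "T (X (X F)) (?b t x k) + q * U (X (X F)) (?b t x k) + s * (U (X F) (?b t x k) + X (U F) (?b t x k))
     + r * (T (U F) (?b t x k) + q * U (U F) (?b t x k)) - T F (?b t x k) + r * real n * k ^ (n - 1) * X F (?b t x k)
     + r * k ^ n * (U (X F) (?b t x k) + 2 * X (U F) (?b t x k))
     - (real n + 1) * (real n + 2) / 2 * k ^ n * X F (?b t x k) + k ^ n * X (X (X F)) (?b t x k) = 0" for t x k q r s
    using euler[of t x k q s r] by (simp add: Let_def T_def X_def U_def)
  \<comment> \<open>The left side of \<open>e\<close> is a polynomial in the free values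
    \<open>q\<close>, \<open>r\<close>, \<open>s\<close>. This equation is its coefficient of
    \<open>q * r\<close>; the next three are those of \<open>s\<close> and \<open>r\<close> and the
    constant term.\<close>
  have UU: "U (U F) (?b t x k) = 0" for t x k
    using e[where q = 1 and r = 1 and s = 0, of t x k] e[where q = 0 and r = 0 and s = 0, of t x k]
      e[where q = 1 and r = 0 and s = 0, of t x k] e[where q = 0 and r = 1 and s = 0, of t x k]
    by (simp add: algebra_simps)
  have UX: "U (X F) (?b t x k) + X (U F) (?b t x k) = 0" for t x k
    using e[where q = 0 and r = 0 and s = 1, of t x k] e[where q = 0 and r = 0 and s = 0, of t x k]
    by simp
  have R: "T (U F) (?b t x k) + real n * k ^ (n - 1) * X F (?b t x k)
      + k ^ n * (U (X F) (?b t x k) + 2 * X (U F) (?b t x k)) = 0" for t x k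
    using e[where q = 0 and r = 1 and s = 0, of t x k] e[where q = 0 and r = 0 and s = 0, of t x k]
    by simp
  have rest: "T (X (X F)) (?b t x k) - T F (?b t x k) - (real n + 1) * (real n + 2) / 2 * k ^ n * X F (?b t x k)
     + k ^ n * X (X (X F)) (?b t x k) = 0" for t x k
    using e[where q = 0 and r = 0 and s = 0, of t x k] by simp
  have UF: "U F (?b t x u) = U F (?b t x 0)" for t x u
  proof (rule DERIV_isconst_all[where f = "\<lambda>u. U F (?b t x u)"], intro allI)
    show "((\<lambda>u. U F (?b t x u)) has_real_derivative 0) (at u)" for u
      using dU[OF ord(3)[OF F], of t x u] by (simp add: UU)
  qed
  have F_affine: "F (?b t x u) = F (?b t x 0) + u * U F (?b t x 0)" for t x u
  proof -
    have "F (?b t x u) - u * U F (?b t x 0) = F (?b t x 0) - 0 * U F (?b t x 0)"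
    proof (rule DERIV_isconst_all[where f = "\<lambda>u. F (?b t x u) - u * U F (?b t x 0)"], intro allI)
      show "((\<lambda>u. F (?b t x u) - u * U F (?b t x 0)) has_real_derivative 0) (at u)" for u
        using dU[OF F, of t x u] UF[of t x u] by (auto intro!: derivative_eq_intros)
    qed
    then show ?thesis by simp
  qed
  have XF_affine: "X F (?b t x u) = X F (?b t x 0) + u * X (U F) (?b t x 0)" for t x u
  proof (rule DERIV_unique)
    show "((\<lambda>s. F (?b t s u)) has_real_derivative X F (?b t x u)) (at x)"
      by (rule dX[OF F])
    have "((\<lambda>s. F (?b t s 0) + u * U F (?b t s 0)) has_real_derivative
        X F (?b t x 0) + u * X (U F) (?b t x 0)) (at x)"
      by (intro DERIV_add DERIV_cmult dX F ord)
    then show "((\<lambda>s. F (?b t s u)) has_real_derivative X F (?b t x 0) + u * X (U F) (?b t x 0)) (at x)"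
      by (simp add: F_affine[symmetric])
  qed
  have XU: "X (U F) (?b t x u) = X (U F) (?b t x 0)" for t x u
  proof (rule DERIV_unique)
    show "((\<lambda>s. U F (?b t s 0)) has_real_derivative X (U F) (?b t x u)) (at x)"
      using dX[OF ord(3)[OF F], of t u x] unfolding UF[of t _ u] .
  qed (rule dX[OF ord(3)[OF F]])
  have UXF: "U (X F) (?b t x u) = X (U F) (?b t x 0)" for t x u
  proof (rule DERIV_unique)
    show "((\<lambda>s. X F (?b t x s)) has_real_derivative U (X F) (?b t x u)) (at u)"
      by (rule dU[OF ord(2)[OF F]])
    have "(\<lambda>s. X F (?b t x s)) = (\<lambda>s. X F (?b t x 0) + s * X (U F) (?b t x 0))"
      by (rule ext) (rule XF_affine)
    then show "((\<lambda>s. X F (?b t x s)) has_real_derivative X (U F) (?b t x 0)) (at u)"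
      by (auto intro!: derivative_eq_intros)
  qed
  \<comment> \<open>Both summands of \<open>UX\<close> are now known to equal \<open>X (U F)\<close>
    at \<open>u = 0\<close>, so twice that value is zero.\<close>
  have XU0: "X (U F) (?b t x u) = 0" for t x u
    using UX[of t x u] XU[of t x u] UXF[of t x u] by simp
  \<comment> \<open>The value 1 is chosen because the powers of \<open>k\<close> in \<open>R\<close>
    become 1 at \<open>k = 1\<close>.\<close>
  have XF: "X F (?b t x u) = X F (?b t x 1)" for t x u
    using XF_affine[of t x u] XF_affine[of t x 1] by (simp add: XU0)
  have UF_x: "U F (?b t x u) = U F (?b t 0 u)" for t x u
    by (rule DERIV_isconst_all[where f = "\<lambda>x. U F (?b t x u)"])
      (use dX[OF ord(3)[OF F]] in \<open>auto simp: XU0\<close>)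
  have TU: "T (U F) (?b t x u) = T (U F) (?b t 0 0)" for t x u
  proof (rule DERIV_unique)
    show "((\<lambda>s. U F (?b s 0 0)) has_real_derivative T (U F) (?b t x u)) (at t)"
      using dT[OF ord(3)[OF F], of x u t] unfolding UF[of _ x u] UF_x[of _ x 0] .
  qed (rule dT[OF ord(3)[OF F]])
  have R1: "T (U F) (?b t 0 0) = - real n * X F (?b t x 1)" for t x
    using R[of t x 1] XU0[of t x 1] UXF[of t x 1] XU0[of t x 0] TU[of t x 1] by simp
  \<comment> \<open>The left side of \<open>R1\<close> is a function of \<open>t\<close> alone, and
    \<open>n\<close> is nonzero, so \<open>X F\<close> is a function of \<open>t\<close> alone
    too.\<close>
  have XF_x: "X F (?b t x u) = X F (?b t 0 1)" for t x u
    using R1[of t x] R1[of t 0] XF[of t x u] \<open>n \<ge> 1\<close> by simp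
  have XX: "X (X F) (?b t x u) = 0" for t x u
    using dX[OF ord(2)[OF F], of t u x] unfolding XF_x[of t _ u]
    by (rule DERIV_unique) (rule DERIV_const)
  have XXX: "X (X (X F)) (?b t x u) = 0" "T (X (X F)) (?b t x u) = 0" for t x u
    by (rule DERIV_unique[OF dX[OF ord(2)[OF ord(2)[OF F]], unfolded XX] DERIV_const])
      (rule DERIV_unique[OF dT[OF ord(2)[OF ord(2)[OF F]], unfolded XX] DERIV_const])
  have TF: "T F (?b t x k) = - ((real n + 1) * (real n + 2) / 2) * k ^ n * X F (?b t 0 1)" for t x k
    using rest[of t x k] by (simp add: XXX XF_x[of t x k])
  have TF1: "T F (?b t x 1) = T F (?b t x 0) + T (U F) (?b t 0 0)" for t x
  proof (rule DERIV_unique)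
    show "((\<lambda>s. F (?b s x 1)) has_real_derivative T F (?b t x 1)) (at t)"
      by (rule dT[OF F])
    have "((\<lambda>s. F (?b s x 0) + 1 * U F (?b s x 0)) has_real_derivative
        T F (?b t x 0) + 1 * T (U F) (?b t x 0)) (at t)"
      by (intro DERIV_add DERIV_cmult dT F ord)
    then show "((\<lambda>s. F (?b s x 1)) has_real_derivative T F (?b t x 0) + T (U F) (?b t 0 0)) (at t)"
      unfolding F_affine[symmetric] by (simp add: TU[of t x 0])
  qed
  \<comment> \<open>By \<open>TF\<close>, \<open>T F\<close> is proportional to the
    \<open>n\<close>-th power of \<open>u\<close>, hence zero at \<open>u = 0\<close>. Its increment
    from 0 to 1 is computed from \<open>TF\<close> and, by affineness, from \<open>R1\<close>;
    equating the two leaves \<open>X F\<close> with the factor \<open>(n^2 + n + 2) / 2\<close>,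
    which is positive.\<close>
  have XF0: "X F (?b t x u) = 0" for t x u
  proof -
    have zero: "(0::real) ^ n = 0" using \<open>n \<ge> 1\<close> by simp
    have "((real n + 1) * (real n + 2) / 2 - real n) * X F (?b t 0 1) = 0"
      using TF1[of t 0] unfolding TF R1[of t 0] left_diff_distrib zero by simp
    moreover have "(real n + 1) * (real n + 2) / 2 - real n > 0"
      by (simp add: algebra_simps add_nonneg_pos add_pos_nonneg)
    ultimately show ?thesis using XF_x[of t x u] by simp
  qed
  have TF0: "T F (?b t x u) = 0" for t x u
    using TF[of t x u] by (simp add: XF0)
  have "F (?b t x u) = F (?b 0 0 0) + U F (?b 0 0 0) * u" for t x u
  proof -
    have "F (?b t x u) = F (?b 0 x u)"
      by (rule DERIV_isconst_all[where f = "\<lambda>t. F (?b t x u)"]) (use dT[OF F] in \<open>auto simp: TF0\<close>)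
    also have "\<dots> = F (?b 0 0 u)"
      by (rule DERIV_isconst_all[where f = "\<lambda>x. F (?b 0 x u)"]) (use dX[OF F] in \<open>auto simp: XF0\<close>)
    finally show ?thesis using F_affine[of 0 0 u] by (simp add: mult.commute)
  qed
  then show ?thesis by blast
qed

lemma affine_if_characteristic:
  assumes "n \<ge> 1" and ch: "characteristic_of_order 0 (E_eq n) (on_jets Q)"
  shows "\<exists>c1 c2. \<forall>t x u. Q t x u = c1 + c2 * u"
proof -
  obtain C0 C1 where cc: "conserved_current (E_eq n) C0 C1"
    and div: "\<forall>D u. open D \<longrightarrow> smooth_on_plane D u \<longrightarrow> (\<forall>(t, x)\<in>D.
      total_t C0 (jet_of u t x) + total_x C1 (jet_of u t x) = on_jets Q (jet_of u t x) * E_eq n (jet_of u t x))"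
    using ch unfolding characteristic_of_order_def by blast
  have div': "total_t C0 (jet_of (sepsum L) t x) + total_x C1 (jet_of (sepsum L) t x)
       = on_jets Q (jet_of (sepsum L) t x) * E_eq n (jet_of (sepsum L) t x)" for L t x
  proof -
    \<comment> \<open>The divergence identity is exploited only for polynomials, on the whole
      plane.\<close>
    have "\<forall>(t, x)\<in>UNIV. total_t C0 (jet_of (sepsum L) t x) + total_x C1 (jet_of (sepsum L) t x)
       = on_jets Q (jet_of (sepsum L) t x) * E_eq n (jet_of (sepsum L) t x)"
      using div open_UNIV smooth_on_plane_sepsum by blast
    then show ?thesis by simp
  qed
  have C: "differential_function C0" "differential_function C1"
    using cc unfolding conserved_current_def by simp_all
  obtain m0 m1 where m: "differential_function_of_order m0 C0" "differential_function_of_order m1 C1"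
    using C unfolding differential_function_def by blast
  have mm: "differential_function_of_order (max m0 m1) C0" "differential_function_of_order (max m0 m1) C1"
    using m unfolding differential_function_of_order_def
    by (meson depends_only_on_mono jvars_upto_mono max.cobounded1 max.cobounded2)+
  have F: "order0 (on_jets Q)"
    using ch unfolding characteristic_of_order_def differential_function_of_order_def order0_def by blast
  have "\<exists>c1 c2. \<forall>t x u. on_jets Q (base_jet t x u) = c1 + c2 * u"
    using euler_condition[OF F mm div']
    by (intro order0_affine[OF \<open>n \<ge> 1\<close> F]) (simp only: Let_def)
  then show ?thesis by (simp add: on_jets_def base_jet_def)
qed

section \<open>Total derivatives and the two currents\<close>

lemma differential_functionI:
  "jsmooth F \<Longrightarrow> depends_only_on F (jvars_upto m) \<Longrightarrow> differential_function F"
  unfolding differential_function_def differential_function_of_order_def by blast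

lemma differential_function_pairE:
  assumes "differential_function F" "differential_function G"
  obtains m where "depends_only_on F (jvars_upto m)" "depends_only_on G (jvars_upto m)" "F \<in> jalgebra" "G \<in> jalgebra"
proof -
  obtain k l where "differential_function_of_order k F" "differential_function_of_order l G"
    using assms unfolding differential_function_def by blast
  then show ?thesis
    using that[of "max k l"] unfolding differential_function_of_order_def
    by (metis depends_only_on_mono jvars_upto_mono max.cobounded1 max.cobounded2 jalgebra.smooth)
qed

lemma differential_function_const: "differential_function (\<lambda>_. c)"
  by (rule differential_functionI[of _ 0]) (auto simp: depends_only_on_def intro: jsmooth_const)

lemma differential_function_coord: "differential_function (\<lambda>p. p (Uvar i j))"
  by (rule differential_functionI[of _ "i + j"])
    (auto simp: depends_only_on_def jvars_upto_def intro: jsmooth_coord)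

lemma differential_function_add:
  assumes "differential_function F" "differential_function G"
  shows "differential_function (\<lambda>p. F p + G p)"
proof -
  from assms obtain m where m: "depends_only_on F (jvars_upto m)" "depends_only_on G (jvars_upto m)"
    "F \<in> jalgebra" "G \<in> jalgebra"
    by (rule differential_function_pairE)
  then show ?thesis
    by (intro differential_functionI[of _ m] jsmooth_add)
      (auto simp: jalgebra_iff depends_only_on_def, metis)
qed

lemma differential_function_mult:
  assumes "differential_function F" "differential_function G"
  shows "differential_function (\<lambda>p. F p * G p)"
proof -
  from assms obtain m where m: "depends_only_on F (jvars_upto m)" "depends_only_on G (jvars_upto m)"
    "F \<in> jalgebra" "G \<in> jalgebra"
    by (rule differential_function_pairE)
  then show ?thesis
    by (intro differential_functionI[of _ m] jsmooth_mult)
      (auto simp: jalgebra_iff depends_only_on_def, metis)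
qed

lemma differential_function_power:
  "differential_function F \<Longrightarrow> differential_function (\<lambda>p. F p ^ k)"
  by (induction k) (auto intro: differential_function_const differential_function_mult)

lemma total_const: "total_t (\<lambda>_. c) p = 0" "total_x (\<lambda>_. c) p = 0"
  by (simp_all add: total_t_def total_x_def)

lemma total_coord:
  "total_t (\<lambda>p. p (Uvar i j)) p = p (Uvar (Suc i) j)"
  "total_x (\<lambda>p. p (Uvar i j)) p = p (Uvar i (Suc j))"
proof -
  have "{(i', j'). jpartial (Uvar i' j') (\<lambda>p. p (Uvar i j)) p \<noteq> 0} = {(i, j)}"
    by (auto simp: jpartial_coord split: if_splits)
  then show "total_t (\<lambda>p. p (Uvar i j)) p = p (Uvar (Suc i) j)"
    "total_x (\<lambda>p. p (Uvar i j)) p = p (Uvar i (Suc j))"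
    by (simp_all add: total_t_def total_x_def jpartial_coord)
qed

lemma total_add:
  assumes "differential_function F" "differential_function G"
  shows "total_t (\<lambda>p. F p + G p) p = total_t F p + total_t G p"
    and "total_x (\<lambda>p. F p + G p) p = total_x F p + total_x G p"
proof -
  from assms obtain m where m: "depends_only_on F (jvars_upto m)" "depends_only_on G (jvars_upto m)"
    and alg: "F \<in> jalgebra" "G \<in> jalgebra"
    by (rule differential_function_pairE)
  have s: "depends_only_on (\<lambda>p. F p + G p) (jvars_upto m)"
    using m unfolding depends_only_on_def by metis
  show "total_t (\<lambda>p. F p + G p) p = total_t F p + total_t G p"
    "total_x (\<lambda>p. F p + G p) p = total_x F p + total_x G p"
    unfolding total_t_eq[OF m(1)] total_t_eq[OF m(2)] total_t_eq[OF s]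
      total_x_eq[OF m(1)] total_x_eq[OF m(2)] total_x_eq[OF s] jpartial_add[OF alg]
    by (simp_all add: case_prod_unfold algebra_simps sum.distrib)
qed

lemma total_mult:
  assumes "differential_function F" "differential_function G"
  shows "total_t (\<lambda>p. F p * G p) p = total_t F p * G p + F p * total_t G p"
    and "total_x (\<lambda>p. F p * G p) p = total_x F p * G p + F p * total_x G p"
proof -
  from assms obtain m where m: "depends_only_on F (jvars_upto m)" "depends_only_on G (jvars_upto m)"
    and alg: "F \<in> jalgebra" "G \<in> jalgebra"
    by (rule differential_function_pairE)
  have s: "depends_only_on (\<lambda>p. F p * G p) (jvars_upto m)"
    using m unfolding depends_only_on_def by metis
  show "total_t (\<lambda>p. F p * G p) p = total_t F p * G p + F p * total_t G p"
    "total_x (\<lambda>p. F p * G p) p = total_x F p * G p + F p * total_x G p"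
    unfolding total_t_eq[OF m(1)] total_t_eq[OF m(2)] total_t_eq[OF s]
      total_x_eq[OF m(1)] total_x_eq[OF m(2)] total_x_eq[OF s] jpartial_mult[OF alg]
    by (simp_all add: case_prod_unfold algebra_simps sum.distrib sum_distrib_left)
qed

lemma total_x_power:
  assumes "differential_function F"
  shows "total_x (\<lambda>p. F p ^ k) p = real k * F p ^ (k - 1) * total_x F p"
proof (induction k)
  case 0
  then show ?case by (simp add: total_const)
next
  case (Suc k)
  have "total_x (\<lambda>p. F p ^ Suc k) p = total_x F p * F p ^ k + F p * total_x (\<lambda>p. F p ^ k) p"
    using total_mult(2)[OF assms differential_function_power[OF assms, of k]] by simp
  then show ?case using Suc by (cases k) (simp_all add: algebra_simps)
qed

lemmas differential_function_intros = differential_function_const differential_function_coord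
  differential_function_add differential_function_mult differential_function_power

text \<open>The identity is stated at every point of the jet space and so covers all functions
  \<open>u\<close> on all open sets at once.\<close>

lemma divergence_identity:
  assumes "n \<ge> 1"
  obtains C0 C1 where "differential_function C0" "differential_function C1"
    "\<And>p. total_t C0 p + total_x C1 p = (c1 + c2 * p (Uvar 0 0)) * E_eq n p"
proof
  \<comment> \<open>The densities are \<open>u - u_xx\<close> for the characteristic 1 and
    \<open>(u^2 + u_x^2) / 2\<close> for \<open>u\<close>; the latter comes from
    \<open>u * (u_t - u_txx) = D_t ((u^2 + u_x^2) / 2) - D_x (u * u_tx)\<close>. Differences are
    written as sums with negative coefficients to fit the rules for sums, products and
    powers.\<close>
  define C0 :: "jet \<Rightarrow> real" where
    "C0 = (\<lambda>p. c1 * p (Uvar 0 0) + - c1 * p (Uvar 0 2)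
       + (c2 / 2 * (p (Uvar 0 0) * p (Uvar 0 0)) + c2 / 2 * (p (Uvar 0 1) * p (Uvar 0 1))))"
  define C1 :: "jet \<Rightarrow> real" where
    "C1 = (\<lambda>p. c1 * (real n + 2) / 2 * p (Uvar 0 0) ^ (n + 1)
       + - c1 * (p (Uvar 0 0) ^ n * p (Uvar 0 2))
       + - c1 * real n / 2 * (p (Uvar 0 0) ^ (n - 1) * (p (Uvar 0 1) * p (Uvar 0 1)))
       + (- c2 * (p (Uvar 0 0) * p (Uvar 1 1))
       + c2 * (real n + 1) / 2 * p (Uvar 0 0) ^ (n + 2)
       + - c2 * (p (Uvar 0 0) ^ (n + 1) * p (Uvar 0 2))
       + c2 * (1 - real n) / 2 * (p (Uvar 0 0) ^ n * (p (Uvar 0 1) * p (Uvar 0 1)))))"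
  show "differential_function C0" "differential_function C1"
    unfolding C0_def C1_def by (intro differential_function_intros)+
  fix p :: jet
  define u where "u = p (Uvar 0 0)"
  define ux where "ux = p (Uvar 0 1)"
  define uxx where "uxx = p (Uvar 0 2)"
  define uxxx where "uxxx = p (Uvar 0 3)"
  define ut where "ut = p (Uvar 1 0)"
  define utx where "utx = p (Uvar 1 1)"
  define utxx where "utxx = p (Uvar 1 2)"
  note vars = u_def ux_def uxx_def uxxx_def ut_def utx_def utxx_def
  have t: "total_t C0 p = c1 * ut - c1 * utxx + c2 * (u * ut + ux * utx)"
    unfolding C0_def
    by (simp only: total_add total_mult total_const total_coord differential_function_intros)
      (simp add: vars numeral_2_eq_2 algebra_simps)
  have x: "total_x C1 p = c1 * (real n + 2) / 2 * (real (n + 1) * u ^ n * ux)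
       - c1 * (real n * u ^ (n - 1) * ux * uxx + u ^ n * uxxx)
       - c1 * real n / 2 * (real (n - 1) * u ^ (n - 1 - 1) * ux * (ux * ux) + u ^ (n - 1) * (2 * ux * uxx))
       + (- c2 * (ux * utx + u * utxx)
       + c2 * (real n + 1) / 2 * (real (n + 2) * u ^ (n + 1) * ux)
       - c2 * (real (n + 1) * u ^ n * ux * uxx + u ^ (n + 1) * uxxx)
       + c2 * (1 - real n) / 2 * (real n * u ^ (n - 1) * ux * (ux * ux) + u ^ n * (2 * ux * uxx)))"
    unfolding C1_def
    by (simp only: total_add total_mult total_x_power total_const total_coord differential_function_intros)
      (simp add: vars numeral_2_eq_2 numeral_3_eq_3 algebra_simps)
  show "total_t C0 p + total_x C1 p = (c1 + c2 * p (Uvar 0 0)) * E_eq n p"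
  \<comment> \<open>For \<open>n = 1\<close> the terms with truncated exponents have coefficient
    zero; for larger \<open>n\<close> the form \<open>Suc (Suc l)\<close> makes all exponents
    genuine.\<close>
  proof (cases "n = 1")
    case True
    then show ?thesis
      unfolding t x E_eq_def Let_def vars[symmetric]
      by (simp add: field_simps power2_eq_square power3_eq_cube)
  next
    case False
    then obtain l where "n = Suc (Suc l)" using assms by (metis Suc_le_D not0_implies_Suc One_nat_def)
    then show ?thesis
      unfolding t x E_eq_def Let_def vars[symmetric]
      by (simp add: field_simps power2_eq_square power3_eq_cube)
  qed
qed

theorem theorem2p1:
  fixes n :: nat and Q :: "real \<Rightarrow> real \<Rightarrow> real \<Rightarrow> real"
  assumes "n \<ge> 1"
    and "jsmooth (on_jets Q)"
  shows "characteristic_of_order 0 (E_eq n) (on_jets Q) \<longleftrightarrow>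
    (\<exists>c1 c2 :: real. \<forall>t x u. Q t x u = c1 + c2 * u)"
proof
  assume "characteristic_of_order 0 (E_eq n) (on_jets Q)"
  with \<open>n \<ge> 1\<close> show "\<exists>c1 c2. \<forall>t x u. Q t x u = c1 + c2 * u"
    by (rule affine_if_characteristic)
next
  assume "\<exists>c1 c2. \<forall>t x u. Q t x u = c1 + c2 * u"
  then obtain c1 c2 where Q: "\<And>t x u. Q t x u = c1 + c2 * u" by blast
  obtain C0 C1 where C: "differential_function C0" "differential_function C1"
    and div: "\<And>p. total_t C0 p + total_x C1 p = (c1 + c2 * p (Uvar 0 0)) * E_eq n p"
    using divergence_identity[OF \<open>n \<ge> 1\<close>] by metis
  have "differential_function_of_order 0 (on_jets Q)"
    using assms(2) unfolding differential_function_of_order_def depends_only_on_def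
    by (auto simp: jvars_upto_0 on_jets_def)
  \<comment> \<open>Along a solution the factor \<open>E\<close> of the divergence is zero.\<close>
  moreover have "conserved_current (E_eq n) C0 C1"
    using C div unfolding conserved_current_def solution_on_def by auto
  ultimately show "characteristic_of_order 0 (E_eq n) (on_jets Q)"
    using div Q unfolding characteristic_of_order_def on_jets_def by auto
qed

end
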